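(* Let $\lambda\in\mathbb{C}$, $\mu\in(-1/2,\infty)\setminus\{0\}$, $\rho\in(0,1)$, $x\in[-1,1]$, and let $R=\sqrt{1+\rho^2-2\rho x}$. Then $$(1-x^2)^{1/4-\mu/2}\,P_{\mu-\lambda-1/2}^{1/2-\mu}(R+\rho)\,\mathrm{P}_{\mu-\lambda-1/2}^{1/2-\mu}(R-\rho)=\frac{2^{1/2-\mu}}{\Gamma(\mu+\frac12)}\sum_{n=0}^\infty\frac{(\lambda)_n\,(2\mu-\lambda)_n}{(2\mu)_n\,\Gamma(\mu+\frac12+n)}\,\rho^{\mu-1/2+n}\,C_n^\mu(x).$$
   Context: $(z)_n=\prod_{i=1}^n(z+i-1)$ is the Pochhammer symbol. ${}_2F_1(a,b;c;z)=\sum_{n\ge0}\frac{(a)_n(b)_n}{(c)_n}\frac{z^n}{n!}$ is the Gauss hypergeometric function, analytically continued to $\mathbb{C}\setminus[1,\infty)$. The Gegenbauer polynomials are $C_n^\mu(z)=\frac{(2\mu)_n}{n!}\,{}_2F_1(-n,n+2\mu;\mu+\frac12;\frac{1-z}{2})$. The associated Legendre function of the first kind (italic $P$) on $\mathbb{C}\setminus(-\infty,1]$ is $P_\nu^\mu(z)=\frac{1}{\Gamma(1-\mu)}\left(\frac{z+1}{z-1}\right)^{\mu/2}{}_2F_1(-\nu,\nu+1;1-\mu;\frac{1-z}{2})$, and the Ferrers function of the first kind (roman $\mathrm{P}$) on $(-1,1)$ is $\mathrm{P}_\nu^\mu(x)=\frac{1}{\Gamma(1-\mu)}\left(\frac{1+x}{1-x}\right)^{\mu/2}{}_2F_1(-\nu,\nu+1;1-\mu;\frac{1-x}{2})$.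 At $x=\pm1$ the left-hand side is understood as its limit as $x\to\pm1$ from within $(-1,1)$. *)

theory Defs
  imports "HOL-Analysis.Analysis"
begin

definition hyp2F1_term :: "complex \<Rightarrow> complex \<Rightarrow> complex \<Rightarrow> complex \<Rightarrow> nat \<Rightarrow> complex" where
  "hyp2F1_term a b c z n =
     pochhammer a n * pochhammer b n / pochhammer c n * (z ^ n / fact n)"

text \<open>
  The Gauss series diverges for \<open>norm z > 1\<close> unless it terminates. Where it converges we take
  its sum: this covers the open unit disc, the terminating case (a polynomial, defined for all
  \<open>z\<close>, also on the cut \<open>[1, \<infinity>)\<close>), and some points of the unit circle, where by
  Abel's theorem the sum is the value of the continuation, or its limit at \<open>z = 1\<close>.
  Elsewhere in the cut plane the value is that of the holomorphic function on \<open>\<complex> - [1, \<infinity>)\<close>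
  that extends the series; it is unique by the identity theorem.
  The parameter \<open>c\<close>, and likewise \<open>1 - \<mu>\<close> in the Legendre and Ferrers functions below, is
  meant not to be a nonpositive integer.
\<close>

definition hyp2F1 :: "complex \<Rightarrow> complex \<Rightarrow> complex \<Rightarrow> complex \<Rightarrow> complex" where
  "hyp2F1 a b c z =
     (if summable (hyp2F1_term a b c z) then (\<Sum>n. hyp2F1_term a b c z n)
      else (THE w. \<exists>f. f holomorphic_on - (complex_of_real ` {1..}) \<and>
                       (\<forall>u\<in>ball 0 1. f u = (\<Sum>n. hyp2F1_term a b c u n)) \<and> w = f z))"

definition gegenbauer :: "nat \<Rightarrow> complex \<Rightarrow> complex \<Rightarrow> complex" where
  "gegenbauer n \<mu> z =
     pochhammer (2 * \<mu>) n / fact n *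
     hyp2F1 (- of_nat n) (of_nat n + 2 * \<mu>) (\<mu> + 1 / 2) ((1 - z) / 2)"

text \<open>
  The associated Legendre function of the first kind, for \<open>z\<close> in \<open>\<complex> - (-\<infinity>, 1]\<close>; there
  \<open>(z + 1) / (z - 1)\<close> avoids \<open>(-\<infinity>, 0]\<close>, so the principal power is holomorphic.
\<close>

definition legendre_P :: "complex \<Rightarrow> complex \<Rightarrow> complex \<Rightarrow> complex" where
  "legendre_P \<nu> \<mu> z =
     1 / Gamma (1 - \<mu>) * ((z + 1) / (z - 1)) powr (\<mu> / 2) *
     hyp2F1 (- \<nu>) (\<nu> + 1) (1 - \<mu>) ((1 - z) / 2)"

text \<open>The Ferrers function of the first kind, for \<open>x\<close> in \<open>(-1, 1)\<close>.\<close>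

definition ferrers_P :: "complex \<Rightarrow> complex \<Rightarrow> real \<Rightarrow> complex" where
  "ferrers_P \<nu> \<mu> x =
     1 / Gamma (1 - \<mu>) * complex_of_real ((1 + x) / (1 - x)) powr (\<mu> / 2) *
     hyp2F1 (- \<nu>) (\<nu> + 1) (1 - \<mu>) (complex_of_real ((1 - x) / 2))"

end

theory Submission
  imports Defs "HOL-Complex_Analysis.Complex_Analysis"
begin

text \<open>
  Put \<open>g = \<mu> + 1 / 2\<close>, \<open>b = 2 * \<mu> - lam\<close>, and let \<open>F\<close> be the Gauss function with parameters \<open>lam, b; g\<close>.
  Euler's transformation rewrites both Legendre functions in terms of \<open>F\<close>, at the points
  \<open>u = (1 - R - \<rho>) / 2\<close> and \<open>v = (1 - R + \<rho>) / 2\<close>, and the algebraic prefactors combine to a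
  constant because \<open>((R + \<rho>)\<^sup>2 - 1) * (1 - (R - \<rho>)\<^sup>2) = 4 * \<rho>\<^sup>2 * (1 - x\<^sup>2)\<close>. What remains is
  Brafman's generating function (\<open>brafman_ultraspherical\<close>), an expansion of \<open>F(u) * F(v)\<close> in powers
  of \<open>\<rho>\<close> with ultraspherical coefficients.

  The reason for that expansion is the pair of relations \<open>u * (1 - v) = - \<rho> * (1 - x) / 2\<close> and
  \<open>v * (1 - u) = \<rho> * (1 + x) / 2\<close>, together with Bailey's factorization
  \<open>F(u) * F(v) = F\<^sub>4(lam, b; g, g; u * (1 - v), v * (1 - u))\<close>, valid because \<open>lam + b = 2 * g - 1\<close>.
  The terms of total degree \<open>n\<close> of the Appell series \<open>F\<^sub>4\<close> are \<open>\<rho> ^ n\<close> times a multiple of the \<open>n\<close>-th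
  Gegenbauer polynomial (\<open>gegenbauer_expansion\<close>). Bailey's factorization (\<open>bailey_formal\<close>) and the
  formula for the polynomials both come from one computation: the action of the hypergeometric
  operator on \<open>X ^ k * (1 - X) ^ l\<close> (\<open>gegen_op_monomial_fps\<close>).

  The Appell series does not, in general, converge absolutely for all \<open>\<rho> < 1\<close>. So Bailey's
  factorization is used only as an identity of formal power series in \<open>\<rho>\<close>, and convergence comes
  from complex analysis: for complex \<open>\<rho>\<close> in the unit disc the points \<open>u\<close> and \<open>v\<close> also stay in the unit
  disc (\<open>quadratic_root_in_disc\<close>), hence \<open>F(u) * F(v)\<close> is holomorphic there and equal to the sum of
  its Taylor series.
\<close>

unbundle no vec_syntax

section \<open>The hypergeometric series as a formal power series\<close>

definition gauss_fps :: "complex \<Rightarrow> complex \<Rightarrow> complex \<Rightarrow> complex fps" where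
  "gauss_fps a b c = Abs_fps (\<lambda>n. pochhammer a n * pochhammer b n / (pochhammer c n * fact n))"

lemma gauss_fps_nth_0 [simp]: "gauss_fps a b c $ 0 = 1"
  by (simp add: gauss_fps_def)

lemma gauss_fps_commute: "gauss_fps a b c = gauss_fps b a c"
  by (simp add: gauss_fps_def mult.commute)

lemma pochhammer_nonzero:
  fixes c :: complex
  assumes "c \<notin> \<int>\<^sub>\<le>\<^sub>0"
  shows "pochhammer c n \<noteq> 0"
  using assms by (auto simp: pochhammer_eq_0_iff)

lemma nonpos_int_nonzero:
  fixes c :: complex
  assumes "c \<notin> \<int>\<^sub>\<le>\<^sub>0"
  shows "c + of_nat n \<noteq> 0"
  using assms by (metis add_eq_0_iff2 minus_of_nat_in_nonpos_Ints)

lemma gauss_fps_nth_Suc: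
  assumes c: "c \<notin> \<int>\<^sub>\<le>\<^sub>0"
  shows "(of_nat n + 1) * (c + of_nat n) * gauss_fps a b c $ Suc n =
           (a + of_nat n) * (b + of_nat n) * gauss_fps a b c $ n"
proof -
  have "of_nat n + 1 \<noteq> (0 :: complex)"
    using of_nat_neq_0[of n, where 'a = complex] by (simp add: add.commute)
  then show ?thesis
    using pochhammer_nonzero[OF c, of n] nonpos_int_nonzero[OF c, of n]
    by (simp add: gauss_fps_def pochhammer_Suc divide_simps) (simp add: algebra_simps)
qed

text \<open>
  The recurrence never divides by zero at these \<open>c\<close>, so it is a uniqueness principle: every later
  identity between hypergeometric series is proved by checking the recurrence and one initial
  coefficient.
\<close>

lemma gauss_fps_unique:
  assumes c: "c \<notin> \<int>\<^sub>\<le>\<^sub>0"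
    and rec: "\<And>n. (of_nat n + 1) * (c + of_nat n) * F $ Suc n = (a + of_nat n) * (b + of_nat n) * F $ n"
  shows "F = fps_const (F $ 0) * gauss_fps a b c"
proof (rule fps_ext)
  fix n
  show "F $ n = (fps_const (F $ 0) * gauss_fps a b c) $ n"
  proof (induction n)
    case (Suc n)
    have nz: "(of_nat n + 1) * (c + of_nat n) \<noteq> (0 :: complex)"
      using nonpos_int_nonzero[OF c, of n] of_nat_neq_0[of n, where 'a = complex]
      by (simp add: add.commute)
    have "(of_nat n + 1) * (c + of_nat n) * F $ Suc n =
            F $ 0 * ((a + of_nat n) * (b + of_nat n) * gauss_fps a b c $ n)"
      using Suc by (simp only: rec) simp
    also have "\<dots> = (of_nat n + 1) * (c + of_nat n) * (F $ 0 * gauss_fps a b c $ Suc n)"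
      by (subst gauss_fps_nth_Suc[OF c, symmetric]) (simp only: mult_ac)
    finally have "(of_nat n + 1) * (c + of_nat n) * F $ Suc n = \<dots>" .
    then show ?case using nz by (metis fps_mult_left_const_nth mult_left_cancel)
  qed simp
qed

text \<open>
  Comparing coefficients in the hypergeometric differential equation gives the recurrence. This
  lets products of series, whose coefficients are convolutions, be treated by the Leibniz rule.
\<close>

lemma gauss_ODE_iff:
  fixes F :: "complex fps"
  shows "fps_X * (1 - fps_X) * fps_deriv (fps_deriv F)
             + (fps_const c - fps_const (a + b + 1) * fps_X) * fps_deriv F = fps_const (a * b) * F
         \<longleftrightarrow> (\<forall>n. (of_nat n + 1) * (c + of_nat n) * F $ Suc n
                  = (a + of_nat n) * (b + of_nat n) * F $ n)"
proof -
  have coeff: "(fps_X * (1 - fps_X) * fps_deriv (fps_deriv F)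
             + (fps_const c - fps_const (a + b + 1) * fps_X) * fps_deriv F - fps_const (a * b) * F) $ n
       = (of_nat n + 1) * (c + of_nat n) * F $ Suc n - (a + of_nat n) * (b + of_nat n) * F $ n"
    for n
  proof -
    have "fps_X * (1 - fps_X) * fps_deriv (fps_deriv F)
             + (fps_const c - fps_const (a + b + 1) * fps_X) * fps_deriv F - fps_const (a * b) * F
        = fps_X * fps_deriv (fps_deriv F) - fps_X * (fps_X * fps_deriv (fps_deriv F))
          + fps_const c * fps_deriv F - fps_const (a + b + 1) * (fps_X * fps_deriv F) - fps_const (a * b) * F"
      by (simp add: algebra_simps)
    then show ?thesis
      by (cases n) (simp_all add: algebra_simps fps_X_mult_nth split: nat.split)
  qed
  have "fps_X * (1 - fps_X) * fps_deriv (fps_deriv F)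
             + (fps_const c - fps_const (a + b + 1) * fps_X) * fps_deriv F = fps_const (a * b) * F
     \<longleftrightarrow> (\<forall>n. (fps_X * (1 - fps_X) * fps_deriv (fps_deriv F)
             + (fps_const c - fps_const (a + b + 1) * fps_X) * fps_deriv F - fps_const (a * b) * F) $ n = 0)"
    by (subst eq_iff_diff_eq_0) (simp only: fps_eq_iff fps_zero_nth)
  then show ?thesis by (simp only: coeff right_minus_eq)
qed

lemma tendsto_shift_ratio:
  fixes a c :: complex
  shows "(\<lambda>n. (a + of_nat n) / (c + of_nat n)) \<longlonglongrightarrow> 1"
proof -
  have "(\<lambda>n. (a / of_nat n + 1) / (c / of_nat n + 1)) \<longlonglongrightarrow> (0 + 1) / (0 + 1)"
    by (intro tendsto_intros lim_const_over_n) auto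
  moreover have "eventually (\<lambda>n. (a / of_nat n + 1) / (c / of_nat n + 1)
                    = (a + of_nat n) / (c + of_nat n)) sequentially"
    using eventually_gt_at_top[of 0]
  proof eventually_elim
    case (elim n)
    have "(a / of_nat n + 1) = (a + of_nat n) / of_nat n" "(c / of_nat n + 1) = (c + of_nat n) / of_nat n"
      using elim by (simp_all add: field_simps)
    then show ?case using elim by simp
  qed
  ultimately show ?thesis by (auto dest: Lim_transform_eventually)
qed

text \<open>
  Ratio test: by the recurrence, consecutive coefficients have a ratio tending to 1. In the
  terminating case coefficients vanish, so the test bounds each one by a multiple of its
  predecessor instead of forming quotients.
\<close>

lemma gauss_fps_conv_radius:
  assumes c: "c \<notin> \<int>\<^sub>\<le>\<^sub>0"
  shows "fps_conv_radius (gauss_fps a b c) \<ge> 1"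
  unfolding fps_conv_radius_def
proof (rule conv_radius_geI_ex)
  fix r :: real assume r: "0 < r" "ereal r < 1"
  then have r1: "r < 1" by simp
  let ?f = "\<lambda>n. gauss_fps a b c $ n"
  let ?q = "\<lambda>n. (a + of_nat n) / (1 + of_nat n) * ((b + of_nat n) / (c + of_nat n)) * of_real r"
  have step: "?f (Suc n) * of_real r ^ Suc n = ?q n * (?f n * of_real r ^ n)" for n
  proof -
    have "1 + of_nat n \<noteq> (0::complex)"
      using of_nat_neq_0[of n, where 'a = complex] by simp
    then have "?f (Suc n) = (a + of_nat n) / (1 + of_nat n) * ((b + of_nat n) / (c + of_nat n)) * ?f n"
      using gauss_fps_nth_Suc[OF c, of n a b] nonpos_int_nonzero[OF c, of n]
      by (simp add: divide_simps) (simp add: algebra_simps)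
    then show ?thesis by (simp add: mult_ac)
  qed
  have "(\<lambda>n. norm (?q n)) \<longlonglongrightarrow> norm (1 * 1 * of_real r :: complex)"
    by (intro tendsto_intros tendsto_shift_ratio)
  then have "(\<lambda>n. norm (?q n)) \<longlonglongrightarrow> r" using r by simp
  then have "eventually (\<lambda>n. norm (?q n) < (1 + r) / 2) sequentially"
    by (rule order_tendstoD) (use r1 in simp)
  then obtain N where N: "\<And>n. n \<ge> N \<Longrightarrow> norm (?q n) < (1 + r) / 2"
    by (auto simp: eventually_sequentially)
  have "summable (\<lambda>n. ?f n * of_real r ^ n)"
  proof (rule summable_ratio_test[where c = "(1 + r) / 2" and N = N])
    show "(1 + r) / 2 < 1" using r1 by simp
    fix n assume "N \<le> n"
    then have "norm (?q n) \<le> (1 + r) / 2" using N by (simp add: less_imp_le)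
    then show "norm (?f (Suc n) * of_real r ^ Suc n) \<le> (1 + r) / 2 * norm (?f n * of_real r ^ n)"
      unfolding step norm_mult[of "?q n"] by (rule mult_right_mono) simp
  qed
  then show "\<exists>z. norm z = r \<and> summable (\<lambda>n. ?f n * z ^ n)"
    using r by (intro exI[of _ "of_real r"]) simp
qed

lemma hyp2F1_term_gauss_fps: "hyp2F1_term a b c z n = gauss_fps a b c $ n * z ^ n"
  by (simp add: hyp2F1_term_def gauss_fps_def)

lemma hyp2F1_eq_eval_fps:
  assumes "summable (\<lambda>n. gauss_fps a b c $ n * z ^ n)"
  shows "hyp2F1 a b c z = eval_fps (gauss_fps a b c) z"
proof -
  have "hyp2F1_term a b c z = (\<lambda>n. gauss_fps a b c $ n * z ^ n)"
    by (rule ext) (rule hyp2F1_term_gauss_fps)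
  then show ?thesis
    using assms by (simp add: hyp2F1_def eval_fps_def)
qed

lemma less_fps_conv_radius_gauss:
  assumes "c \<notin> \<int>\<^sub>\<le>\<^sub>0" "norm z < 1"
  shows "ereal (norm z) < fps_conv_radius (gauss_fps a b c)"
  using assms gauss_fps_conv_radius[of c a b]
  by (metis ereal_less(3) less_le_trans)

section \<open>Euler's transformation\<close>

text \<open>
  The binomial series of \<open>(1 - z) powr e\<close>.
\<close>

definition one_minus_power_fps :: "complex \<Rightarrow> complex fps" where
  "one_minus_power_fps e = Abs_fps (\<lambda>n. pochhammer (- e) n / fact n)"

lemma one_minus_power_fps_sums:
  assumes "norm z < 1"
  shows "(\<lambda>n. one_minus_power_fps e $ n * z ^ n) sums (1 - z) powr e"
proof -
  have "(\<lambda>n. (e gchoose n) * (- z) ^ n) sums (1 + - z) powr e"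
    by (rule gen_binomial_complex) (use assms in simp)
  moreover have "(e gchoose n) * (- z) ^ n = one_minus_power_fps e $ n * z ^ n" for n
  proof -
    have "(- 1 :: complex) ^ n * (- z) ^ n = z ^ n"
      by (simp flip: power_mult_distrib)
    then show ?thesis
      by (simp add: one_minus_power_fps_def gbinomial_pochhammer field_simps)
  qed
  ultimately show ?thesis by simp
qed

lemma one_minus_power_fps_conv_radius: "fps_conv_radius (one_minus_power_fps e) \<ge> 1"
  unfolding fps_conv_radius_def
proof (rule conv_radius_geI_ex)
  fix r :: real assume r: "0 < r" "ereal r < 1"
  then have "norm (of_real r :: complex) < 1" by simp
  from sums_summable[OF one_minus_power_fps_sums[OF this]]
  show "\<exists>z. norm z = r \<and> summable (\<lambda>n. one_minus_power_fps e $ n * z ^ n)"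
    using r by (intro exI[of _ "of_real r"]) simp
qed

lemma one_minus_power_fps_deriv:
  "(1 - fps_X) * fps_deriv (one_minus_power_fps e) = - fps_const e * one_minus_power_fps e"
proof -
  let ?W = "one_minus_power_fps e"
  have rec: "of_nat (Suc n) * ?W $ Suc n = (of_nat n - e) * ?W $ n" for n
    by (simp add: one_minus_power_fps_def pochhammer_Suc divide_simps del: of_nat_Suc)
  have "((1 - fps_X) * fps_deriv ?W) $ n = (- fps_const e * ?W) $ n" for n
  proof -
    have "((1 - fps_X) * fps_deriv ?W) $ n = of_nat (Suc n) * ?W $ Suc n - of_nat n * ?W $ n"
      by (cases n) (simp_all add: left_diff_distrib)
    also have "\<dots> = (- fps_const e * ?W) $ n"
      by (simp only: rec) (simp add: algebra_simps)
    finally show ?thesis .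
  qed
  then show ?thesis by (rule fps_ext)
qed

text \<open>
  The computation behind Euler's transformation, stripped of series: \<open>w\<close> stands for
  \<open>(1 - X) powr (C - A - B)\<close>, \<open>p\<close> for a solution of the equation with parameters \<open>C - A\<close>, \<open>C - B\<close>, and
  \<open>w1\<close>, \<open>w2\<close>, \<open>p1\<close>, \<open>p2\<close> for derivatives. The conclusion says that \<open>w * p\<close> solves the equation with
  parameters \<open>A\<close>, \<open>B\<close>; the factor \<open>1 - X\<close> clears the denominators of the logarithmic derivative of \<open>w\<close>.
\<close>

lemma euler_ODE_product:
  fixes X :: "'a :: comm_ring_1"
  assumes W1: "(1 - X) * w1 = - (C - A - B) * w"
    and W2: "(1 - X) * w2 = (1 - (C - A - B)) * w1"
    and P2: "X * (1 - X) * p2 + (C - (2 * C - A - B + 1) * X) * p1 = (C - A) * (C - B) * p"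
  shows "(1 - X) * (X * (1 - X) * (w2 * p + 2 * w1 * p1 + w * p2)
           + (C - (A + B + 1) * X) * (w1 * p + w * p1)) = (1 - X) * (A * B * (w * p))"
proof -
  let ?D = "1 - X" and ?E = "C - A - B"
  \<comment> \<open>the difference of the two sides is a combination of the three hypotheses\<close>
  have "?D * (X * ?D * (w2 * p + 2 * w1 * p1 + w * p2) + (C - (A + B + 1) * X) * (w1 * p + w * p1))
          - ?D * (A * B * (w * p))
      = (?D * w2 - (1 - ?E) * w1) * (?D * X * p)
        + (?D * w1 + ?E * w) * (X * (1 - ?E) * p + 2 * X * ?D * p1 + (C - (A + B + 1) * X) * p)
        + (X * ?D * p2 + (C - (2 * C - A - B + 1) * X) * p1 - (C - A) * (C - B) * p) * (?D * w)"
    by (simp add: algebra_simps)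
  also have "?D * w2 - (1 - ?E) * w1 = 0" by (simp only: W2 diff_self)
  also have "?D * w1 + ?E * w = 0" by (simp only: W1) (simp add: algebra_simps)
  also have "X * ?D * p2 + (C - (2 * C - A - B + 1) * X) * p1 - (C - A) * (C - B) * p = 0"
    by (simp only: P2 diff_self)
  finally show ?thesis by simp
qed

text \<open>
  Both sides solve the same hypergeometric equation and have constant coefficient 1.
\<close>

lemma euler_transformation_fps:
  assumes c: "c \<notin> \<int>\<^sub>\<le>\<^sub>0"
  shows "gauss_fps a b c = one_minus_power_fps (c - a - b) * gauss_fps (c - a) (c - b) c"
proof -
  let ?e = "c - a - b"
  define W where "W = one_minus_power_fps ?e"
  define P where "P = gauss_fps (c - a) (c - b) c"
  define A B C where "A = fps_const a" and "B = fps_const b" and "C = fps_const c"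
  note ABC = A_def B_def C_def
  let ?D = "1 - fps_X :: complex fps"
  have W1: "?D * fps_deriv W = - (C - A - B) * W"
    using one_minus_power_fps_deriv[of ?e] by (simp add: W_def ABC)
  have "fps_deriv (?D * fps_deriv W) = - (C - A - B) * fps_deriv W"
    unfolding W1 by (simp add: ABC)
  then have W2: "?D * fps_deriv (fps_deriv W) = (1 - (C - A - B)) * fps_deriv W"
    by (simp add: algebra_simps)
  have P2: "fps_X * ?D * fps_deriv (fps_deriv P) + (C - (2 * C - A - B + 1) * fps_X) * fps_deriv P
              = (C - A) * (C - B) * P"
  proof -
    have "fps_const (c - a + (c - b) + 1) = C + C - A - B + 1"
      by (simp add: ABC fps_eq_iff)
    then have "fps_const (c - a + (c - b) + 1) = 2 * C - A - B + 1"
      by (simp only: mult_2)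
    moreover have "fps_const ((c - a) * (c - b)) = (C - A) * (C - B)"
      by (simp add: ABC)
    moreover have "fps_X * ?D * fps_deriv (fps_deriv P)
        + (fps_const c - fps_const (c - a + (c - b) + 1) * fps_X) * fps_deriv P
              = fps_const ((c - a) * (c - b)) * P"
      unfolding gauss_ODE_iff P_def using gauss_fps_nth_Suc[OF c] by blast
    ultimately show ?thesis by (simp only: C_def)
  qed
  have "?D * (fps_X * ?D * fps_deriv (fps_deriv (W * P)) + (C - (A + B + 1) * fps_X) * fps_deriv (W * P))
        = ?D * (A * B * (W * P))"
  proof -
    have d1: "fps_deriv (W * P) = fps_deriv W * P + W * fps_deriv P"
      by (simp add: algebra_simps)
    have d2: "fps_deriv (fps_deriv (W * P)) =
        fps_deriv (fps_deriv W) * P + 2 * fps_deriv W * fps_deriv P + W * fps_deriv (fps_deriv P)"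
      by (simp add: algebra_simps)
    show ?thesis
      unfolding d2 unfolding d1 by (rule euler_ODE_product[OF W1 W2 P2])
  qed
  moreover have "?D \<noteq> 0"
    by (metis eq_iff_diff_eq_0 fps_X_neq_one)
  ultimately have "fps_X * ?D * fps_deriv (fps_deriv (W * P)) + (C - (A + B + 1) * fps_X) * fps_deriv (W * P)
        = A * B * (W * P)"
    by (metis mult_left_cancel)
  moreover have "fps_const (a + b + 1) = A + B + 1" "fps_const (a * b) = A * B"
    by (simp_all add: ABC fps_eq_iff)
  ultimately have "\<forall>n. (of_nat n + 1) * (c + of_nat n) * (W * P) $ Suc n
                  = (a + of_nat n) * (b + of_nat n) * (W * P) $ n"
    unfolding gauss_ODE_iff[symmetric] by (simp add: C_def)
  from gauss_fps_unique[OF c this[rule_format]]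
  have "W * P = fps_const ((W * P) $ 0) * gauss_fps a b c" .
  moreover have "(W * P) $ 0 = 1"
    by (simp add: W_def P_def one_minus_power_fps_def)
  ultimately show ?thesis by (simp add: W_def P_def)
qed

lemma euler_transformation:
  assumes c: "c \<notin> \<int>\<^sub>\<le>\<^sub>0" and z: "norm z < 1"
  shows "eval_fps (gauss_fps a b c) z =
           (1 - z) powr (c - a - b) * eval_fps (gauss_fps (c - a) (c - b) c) z"
proof -
  have "ereal (norm z) < fps_conv_radius (one_minus_power_fps (c - a - b))"
    using one_minus_power_fps_conv_radius z by (metis ereal_less(3) less_le_trans)
  moreover have "eval_fps (one_minus_power_fps (c - a - b)) z = (1 - z) powr (c - a - b)"
    using one_minus_power_fps_sums[OF z] by (simp add: eval_fps_def sums_iff)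
  ultimately show ?thesis
    using less_fps_conv_radius_gauss[OF c z]
    by (subst euler_transformation_fps[OF c]) (simp add: eval_fps_mult)
qed

section \<open>Bailey's factorization of the Appell function\<close>

text \<open>
  With \<open>U = u * (1 - v)\<close> and \<open>V = v * (1 - u)\<close>, a product \<open>U ^ k * V ^ l\<close> is such a monomial in \<open>u\<close>
  times the one with exchanged exponents in \<open>v\<close>.
\<close>

definition monomial_fps :: "nat \<Rightarrow> nat \<Rightarrow> complex fps" where
  "monomial_fps k l = fps_X ^ k * (1 - fps_X) ^ l"

text \<open>
  The hypergeometric differential operator without its zeroth-order term, in the case
  \<open>a + b + 1 = 2 * g\<close>, where it is invariant under \<open>X \<mapsto> 1 - X\<close>.
\<close>

definition gegen_op :: "complex \<Rightarrow> complex fps \<Rightarrow> complex fps" where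
  "gegen_op g F = fps_X * (1 - fps_X) * fps_deriv (fps_deriv F)
                    + fps_const g * (1 - 2 * fps_X) * fps_deriv F"

lemma X_power_deriv:
  fixes k :: nat
  shows "fps_deriv (fps_X ^ k :: complex fps) = of_nat k * fps_X ^ (k - 1)"
    and "fps_X * fps_deriv (fps_deriv (fps_X ^ k :: complex fps)) = of_nat k * (of_nat k - 1) * fps_X ^ (k - 1)"
    and "of_nat k * (fps_X * fps_X ^ (k - 1)) = (of_nat k * fps_X ^ k :: complex fps)"
proof -
  show d: "fps_deriv (fps_X ^ j :: complex fps) = of_nat j * fps_X ^ (j - 1)" for j :: nat
    by (simp add: fps_deriv_power' fps_of_nat)
  show "fps_X * fps_deriv (fps_deriv (fps_X ^ k :: complex fps)) = of_nat k * (of_nat k - 1) * fps_X ^ (k - 1)"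
  proof (cases k)
    case (Suc j)
    have "fps_deriv (of_nat k * F) = of_nat k * fps_deriv F" for F :: "complex fps"
      by (simp flip: fps_of_nat)
    then have "fps_deriv (fps_deriv (fps_X ^ k :: complex fps)) = of_nat k * (of_nat j * fps_X ^ (j - 1))"
      by (simp only: d Suc diff_Suc_1)
    then show ?thesis by (cases j) (simp_all add: Suc algebra_simps)
  qed simp
  show "of_nat k * (fps_X * fps_X ^ (k - 1)) = (of_nat k * fps_X ^ k :: complex fps)"
    by (cases k) simp_all
qed

lemma one_minus_X_power_deriv:
  fixes l :: nat
  defines "D \<equiv> 1 - fps_X :: complex fps"
  shows "fps_deriv (D ^ l) = - of_nat l * D ^ (l - 1)"
    and "D * fps_deriv (fps_deriv (D ^ l)) = of_nat l * (of_nat l - 1) * D ^ (l - 1)"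
    and "of_nat l * (D * D ^ (l - 1)) = of_nat l * D ^ l"
proof -
  show d: "fps_deriv (D ^ j) = - of_nat j * D ^ (j - 1)" for j :: nat
    by (simp add: fps_deriv_power' fps_of_nat D_def)
  show "D * fps_deriv (fps_deriv (D ^ l)) = of_nat l * (of_nat l - 1) * D ^ (l - 1)"
  proof (cases l)
    case (Suc j)
    have "fps_deriv (- of_nat l * F) = - of_nat l * fps_deriv F" for F :: "complex fps"
      by (simp flip: fps_of_nat)
    then have "fps_deriv (fps_deriv (D ^ l)) = - of_nat l * (- of_nat j * D ^ (j - 1))"
      by (simp only: d Suc diff_Suc_1)
    then show ?thesis by (cases j) (simp_all add: Suc algebra_simps)
  qed simp
  show "of_nat l * (D * D ^ (l - 1)) = of_nat l * D ^ l"
    by (cases l) simp_all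
qed

text \<open>
  Leibniz rule for \<open>u = X ^ k\<close> and \<open>v = (1 - X) ^ l\<close>, where \<open>u'\<close> and \<open>v'\<close> are the powers with the
  exponent lowered by one. Lowered powers multiplied by \<open>X\<close> or \<open>1 - X\<close> are raised back only after
  multiplication by the exponent, because exponent 0 cannot be lowered.
\<close>

lemma gegen_op_product:
  fixes X :: "'a :: comm_ring_1"
  assumes U: "u1 = K * u'" "X * u2 = K * (K - 1) * u'" "K * (X * u') = K * u"
    and V: "v1 = - L * v'" "(1 - X) * v2 = L * (L - 1) * v'" "L * ((1 - X) * v') = L * v"
  shows "X * (1 - X) * (u2 * v + 2 * u1 * v1 + u * v2) + G * (1 - 2 * X) * (u1 * v + u * v1)
           = K * (K - 1 + G) * (u' * v) + L * (L - 1 + G) * (u * v')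
             - (K + L) * (K + L - 1 + 2 * G) * (u * v)"
proof -
  have "X * (1 - X) * (u2 * v + 2 * u1 * v1 + u * v2) + G * (1 - 2 * X) * (u1 * v + u * v1)
          - (K * (K - 1 + G) * (u' * v) + L * (L - 1 + G) * (u * v')
             - (K + L) * (K + L - 1 + 2 * G) * (u * v))
      = (X * u2 - K * (K - 1) * u') * ((1 - X) * v)
        + ((1 - X) * v2 - L * (L - 1) * v') * (X * u)
        - (K * (X * u') - K * u) * ((K - 1) * v + 2 * L * (1 - X) * v' + 2 * G * v)
        - (L * ((1 - X) * v') - L * v) * ((L - 1) * u + 2 * K * u + 2 * G * u)"
    unfolding U(1) V(1) by (simp add: algebra_simps)
  then show ?thesis using U(2,3) V(2,3) by simp
qed

text \<open>
  The operator acts on these monomials with only three terms, lowering one of the exponents or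
  keeping both. The coefficients of the lowering terms are exactly the factors that the
  denominators of the Appell coefficients absorb.
\<close>

lemma gegen_op_monomial_fps:
  "gegen_op g (monomial_fps k l) =
     fps_const (of_nat k * (of_nat k - 1 + g)) * monomial_fps (k - 1) l
     + fps_const (of_nat l * (of_nat l - 1 + g)) * monomial_fps k (l - 1)
     - fps_const ((of_nat k + of_nat l) * (of_nat k + of_nat l - 1 + 2 * g)) * monomial_fps k l"
proof -
  let ?D = "1 - fps_X :: complex fps"
  define U U1 V V1 :: "complex fps" where "U = fps_X ^ k" and "U1 = fps_X ^ (k - 1)"
    and "V = ?D ^ l" and "V1 = ?D ^ (l - 1)"
  define K L G :: "complex fps" where "K = of_nat k" and "L = of_nat l" and "G = fps_const g"
  have U: "fps_deriv U = K * U1" "fps_X * fps_deriv (fps_deriv U) = K * (K - 1) * U1"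
     "K * (fps_X * U1) = K * U"
    using X_power_deriv[of k] by (simp_all add: U_def U1_def K_def)
  have V: "fps_deriv V = - L * V1" "?D * fps_deriv (fps_deriv V) = L * (L - 1) * V1"
     "L * (?D * V1) = L * V"
    using one_minus_X_power_deriv[of l] by (simp_all add: V_def V1_def L_def)
  have d1: "fps_deriv (U * V) = fps_deriv U * V + U * fps_deriv V"
    by (simp add: algebra_simps)
  have d2: "fps_deriv (fps_deriv (U * V)) = fps_deriv (fps_deriv U) * V
       + 2 * fps_deriv U * fps_deriv V + U * fps_deriv (fps_deriv V)"
    by (simp add: algebra_simps)
  have op: "gegen_op g (U * V) = K * (K - 1 + G) * (U1 * V) + L * (L - 1 + G) * (U * V1)
          - (K + L) * (K + L - 1 + 2 * G) * (U * V)"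
    unfolding gegen_op_def G_def[symmetric] d2 unfolding d1 by (rule gegen_op_product[OF U V])
  have KL: "K = fps_const (of_nat k)" "L = fps_const (of_nat l)" "(1 :: complex fps) = fps_const 1"
    by (simp_all add: K_def L_def fps_of_nat)
  have "K * (K - 1 + G) = fps_const (of_nat k * (of_nat k - 1 + g))"
    "L * (L - 1 + G) = fps_const (of_nat l * (of_nat l - 1 + g))"
    "(K + L) * (K + L - 1 + 2 * G)
       = fps_const ((of_nat k + of_nat l) * (of_nat k + of_nat l - 1 + 2 * g))"
    by (simp_all only: KL G_def numeral_fps_const fps_const_add fps_const_sub fps_const_mult)
  then show ?thesis
    using op by (simp only: monomial_fps_def U_def U1_def V_def V1_def)
qed

lemma gegen_op_nth:
  "gegen_op g F $ i = (of_nat i + 1) * (g + of_nat i) * F $ Suc i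
                        - of_nat i * (of_nat i - 1 + 2 * g) * F $ i"
proof -
  have "gegen_op g F = fps_X * fps_deriv (fps_deriv F) - fps_X * (fps_X * fps_deriv (fps_deriv F))
          + fps_const g * (fps_deriv F - 2 * (fps_X * fps_deriv F))"
    unfolding gegen_op_def by (simp only: ring_distribs mult_ac mult_1_left mult_1_right add_ac diff_add_eq)
  also have "\<dots> $ i = (of_nat i + 1) * (g + of_nat i) * F $ Suc i
                        - of_nat i * (of_nat i - 1 + 2 * g) * F $ i"
  proof (cases i)
    case 0
    then show ?thesis by (simp add: numeral_fps_const)
  next
    case (Suc j)
    show ?thesis unfolding Suc by (cases j) (simp_all add: numeral_fps_const algebra_simps)
  qed
  finally show ?thesis .
qed

lemma monomial_fps_nth_Suc:
  "(of_nat i + 1) * (g + of_nat i) * monomial_fps k l $ Suc i =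
     of_nat k * (of_nat k - 1 + g) * monomial_fps (k - 1) l $ i
     + of_nat l * (of_nat l - 1 + g) * monomial_fps k (l - 1) $ i
     + (of_nat i * (of_nat i - 1 + 2 * g)
          - (of_nat k + of_nat l) * (of_nat k + of_nat l - 1 + 2 * g)) * monomial_fps k l $ i"
proof -
  have "P = s + (Q - R) * B" if "s - R * B = P - Q * B" for P Q R B s :: complex
    using that by (simp add: algebra_simps)
  then show ?thesis
    using gegen_op_nth[of g "monomial_fps k l" i, unfolded gegen_op_monomial_fps]
    by (simp only: fps_sub_nth fps_add_nth fps_mult_left_const_nth)
qed

lemma monomial_fps_nth_below: "i < k \<Longrightarrow> monomial_fps k l $ i = 0"
  by (simp add: monomial_fps_def fps_X_power_mult_nth)

lemma monomial_fps_nth_0: "monomial_fps k l $ 0 = (if k = 0 then 1 else 0)"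
  by (simp add: monomial_fps_def fps_nth_power_0)

lemma monomial_fps_0_nth: "monomial_fps l 0 $ j = (if j = l then 1 else 0)"
  by (simp add: monomial_fps_def)

lemma monomial_fps_pascal:
  "monomial_fps (Suc k) l + monomial_fps k (Suc l) = monomial_fps k l"
  by (simp add: monomial_fps_def algebra_simps)

text \<open>
  The coefficients of the Appell function \<open>F\<^sub>4\<close> with parameters \<open>a, b; g, g\<close>.
\<close>

definition appell_coeff :: "complex \<Rightarrow> complex \<Rightarrow> complex \<Rightarrow> nat \<Rightarrow> nat \<Rightarrow> complex" where
  "appell_coeff a b g k l = pochhammer a (k + l) * pochhammer b (k + l) /
     (pochhammer g k * pochhammer g l * fact k * fact l)"

lemma appell_coeff_commute: "appell_coeff a b g k l = appell_coeff a b g l k"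
  by (simp add: appell_coeff_def add.commute mult_ac)

lemma appell_coeff_Suc:
  assumes g: "g \<notin> \<int>\<^sub>\<le>\<^sub>0"
  shows "of_nat (Suc k) * (of_nat k + g) * appell_coeff a b g (Suc k) l =
           (a + of_nat (k + l)) * (b + of_nat (k + l)) * appell_coeff a b g k l"
proof -
  have "of_nat (Suc k) \<noteq> (0 :: complex)" by (rule of_nat_neq_0)
  then show ?thesis
    using pochhammer_nonzero[OF g, of k] pochhammer_nonzero[OF g, of l] nonpos_int_nonzero[OF g, of k]
    by (simp add: appell_coeff_def pochhammer_Suc divide_simps del: of_nat_Suc)
qed

lemma appell_coeff_Suc_right:
  assumes g: "g \<notin> \<int>\<^sub>\<le>\<^sub>0"
  shows "of_nat (Suc l) * (of_nat l + g) * appell_coeff a b g k (Suc l) =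
           (a + of_nat (k + l)) * (b + of_nat (k + l)) * appell_coeff a b g k l"
  using appell_coeff_Suc[OF g, of l a b k] by (simp add: appell_coeff_commute add.commute)

text \<open>
  The coefficient form of Bailey's factorization
  \<open>F\<^sub>4(a, b; g, g; u * (1 - v), v * (1 - u)) = F(u) * F(v)\<close>: the left-hand side below is the
  coefficient of \<open>u ^ i * v ^ j\<close> in \<open>F\<^sub>4\<close>. It holds because \<open>F\<^sub>4\<close>, for fixed \<open>v\<close>, solves the
  hypergeometric equation in \<open>u\<close>: the lowering terms of the operator, applied to the summands of
  total degree \<open>n + 1\<close>, reproduce those of degree \<open>n\<close> multiplied by \<open>(1 - v) + v = 1\<close>. So the
  induction on \<open>i\<close> follows the recurrence, and for \<open>i = 0\<close> only the summands with \<open>k = 0\<close> contribute.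
  The bound \<open>M\<close> truncates nothing, as a monomial has no coefficients below its exponent of \<open>X\<close>.
\<close>

lemma gauss_coeff_product:
  assumes g: "g \<notin> \<int>\<^sub>\<le>\<^sub>0" and ab: "a + b = 2 * g - 1" and "i \<le> M" "j \<le> M"
  shows "(\<Sum>k\<le>M. \<Sum>l\<le>M. appell_coeff a b g k l * (monomial_fps k l $ i * monomial_fps l k $ j))
           = gauss_fps a b g $ i * gauss_fps a b g $ j"
  using \<open>i \<le> M\<close>
proof (induction i)
  case 0
  have "(\<Sum>k\<le>M. \<Sum>l\<le>M. appell_coeff a b g k l * (monomial_fps k l $ 0 * monomial_fps l k $ j))
      = (\<Sum>k\<le>M. if k = 0 then \<Sum>l\<le>M. appell_coeff a b g k l * monomial_fps l k $ j else 0)"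
    by (intro sum.cong refl) (simp add: monomial_fps_nth_0)
  also have "\<dots> = (\<Sum>l\<le>M. appell_coeff a b g 0 l * monomial_fps l 0 $ j)"
    by simp
  also have "\<dots> = (\<Sum>l\<le>M. if l = j then appell_coeff a b g 0 l else 0)"
    by (intro sum.cong refl) (simp add: monomial_fps_0_nth)
  also have "\<dots> = appell_coeff a b g 0 j"
    using \<open>j \<le> M\<close> by simp
  finally show ?case by (simp add: appell_coeff_def gauss_fps_def)
next
  case (Suc i)
  then have i: "i < M" by simp
  let ?d = "appell_coeff a b g" and ?B = "\<lambda>k l i. monomial_fps k l $ i"
  define T where "T = (\<lambda>n. (a + of_nat n) * (b + of_nat n))"
  define S where "S = (\<lambda>i. \<Sum>k\<le>M. \<Sum>l\<le>M. ?d k l * (?B k l i * ?B l k j))"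
  \<comment> \<open>the eigenvalue terms of the operator are differences of T; this is where \<open>a + b = 2 * g - 1\<close> enters\<close>
  have T_diff: "T i - T n = of_nat i * (of_nat i - 1 + 2 * g) - of_nat n * (of_nat n - 1 + 2 * g)" for n
  proof -
    have b: "b = 2 * g - 1 - a" using ab by (simp add: algebra_simps)
    show ?thesis unfolding T_def b by (simp add: algebra_simps)
  qed
  have step: "(of_nat i + 1) * (g + of_nat i) * ?B k l (Suc i) =
      of_nat k * (of_nat k - 1 + g) * ?B (k - 1) l i + of_nat l * (of_nat l - 1 + g) * ?B k (l - 1) i
      + (T i - T (k + l)) * ?B k l i" for k l
    using monomial_fps_nth_Suc[of i g k l] by (simp only: T_diff of_nat_add)
  \<comment> \<open>lowering k: shift the summation index, the new top summand being zero because \<open>i < M\<close>\<close>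
  have left: "(\<Sum>k\<le>M. ?d k l * (of_nat k * (of_nat k - 1 + g) * ?B (k - 1) l i * ?B l k j))
      = (\<Sum>k\<le>M. T (k + l) * ?d k l * (?B k l i * ?B l (Suc k) j))" for l
  proof -
    obtain M' where M': "M = Suc M'" using i by (cases M) auto
    have "(\<Sum>k\<le>M. ?d k l * (of_nat k * (of_nat k - 1 + g) * ?B (k - 1) l i * ?B l k j))
        = (\<Sum>k\<le>M'. of_nat (Suc k) * (of_nat k + g) * ?d (Suc k) l * (?B k l i * ?B l (Suc k) j))"
      unfolding M' sum.atMost_Suc_shift by (simp add: algebra_simps)
    also have "\<dots> = (\<Sum>k\<le>M'. T (k + l) * ?d k l * (?B k l i * ?B l (Suc k) j))"
      by (simp only: appell_coeff_Suc[OF g] T_def)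
    also have "\<dots> = (\<Sum>k\<le>M. T (k + l) * ?d k l * (?B k l i * ?B l (Suc k) j))"
      using i by (simp add: M' monomial_fps_nth_below)
    finally show ?thesis .
  qed
  \<comment> \<open>lowering l: the new top summand is zero because \<open>j \<le> M\<close>\<close>
  have right: "(\<Sum>l\<le>M. ?d k l * (of_nat l * (of_nat l - 1 + g) * ?B k (l - 1) i * ?B l k j))
      = (\<Sum>l\<le>M. T (k + l) * ?d k l * (?B k l i * ?B (Suc l) k j))" for k
  proof -
    obtain M' where M': "M = Suc M'" using i by (cases M) auto
    have "(\<Sum>l\<le>M. ?d k l * (of_nat l * (of_nat l - 1 + g) * ?B k (l - 1) i * ?B l k j))
        = (\<Sum>l\<le>M'. of_nat (Suc l) * (of_nat l + g) * ?d k (Suc l) * (?B k l i * ?B (Suc l) k j))"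
      unfolding M' sum.atMost_Suc_shift by (simp add: algebra_simps)
    also have "\<dots> = (\<Sum>l\<le>M'. T (k + l) * ?d k l * (?B k l i * ?B (Suc l) k j))"
      by (simp only: appell_coeff_Suc_right[OF g] T_def)
    also have "\<dots> = (\<Sum>l\<le>M. T (k + l) * ?d k l * (?B k l i * ?B (Suc l) k j))"
      using \<open>j \<le> M\<close> by (simp add: M' monomial_fps_nth_below)
    finally show ?thesis .
  qed
  have pascal: "T (k + l) * ?d k l * (?B k l i * ?B l (Suc k) j)
      + T (k + l) * ?d k l * (?B k l i * ?B (Suc l) k j)
      + (T i - T (k + l)) * ?d k l * (?B k l i * ?B l k j) = T i * (?d k l * (?B k l i * ?B l k j))" for k l
  proof -
    have eq: "?B l k j = ?B (Suc l) k j + ?B l (Suc k) j"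
      by (simp only: monomial_fps_pascal fps_add_nth[symmetric])
    show ?thesis by (subst (1 2) eq) (simp add: algebra_simps)
  qed
  have "(of_nat i + 1) * (g + of_nat i) * S (Suc i)
      = (\<Sum>k\<le>M. \<Sum>l\<le>M. ?d k l * (((of_nat i + 1) * (g + of_nat i) * ?B k l (Suc i)) * ?B l k j))"
    unfolding S_def sum_distrib_left by (intro sum.cong refl) (simp only: mult_ac)
  also have "\<dots> = (\<Sum>k\<le>M. \<Sum>l\<le>M. ?d k l * (of_nat k * (of_nat k - 1 + g) * ?B (k - 1) l i * ?B l k j))
      + (\<Sum>k\<le>M. \<Sum>l\<le>M. ?d k l * (of_nat l * (of_nat l - 1 + g) * ?B k (l - 1) i * ?B l k j))
      + (\<Sum>k\<le>M. \<Sum>l\<le>M. (T i - T (k + l)) * ?d k l * (?B k l i * ?B l k j))"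
    unfolding step sum.distrib[symmetric] by (intro sum.cong refl) (simp only: ring_distribs mult_ac)
  also have "(\<Sum>k\<le>M. \<Sum>l\<le>M. ?d k l * (of_nat k * (of_nat k - 1 + g) * ?B (k - 1) l i * ?B l k j))
      = (\<Sum>k\<le>M. \<Sum>l\<le>M. T (k + l) * ?d k l * (?B k l i * ?B l (Suc k) j))"
    by (subst (1 2) sum.swap) (simp only: left)
  also have "(\<Sum>k\<le>M. \<Sum>l\<le>M. ?d k l * (of_nat l * (of_nat l - 1 + g) * ?B k (l - 1) i * ?B l k j))
      = (\<Sum>k\<le>M. \<Sum>l\<le>M. T (k + l) * ?d k l * (?B k l i * ?B (Suc l) k j))"
    by (simp only: right)
  also have "(\<Sum>k\<le>M. \<Sum>l\<le>M. T (k + l) * ?d k l * (?B k l i * ?B l (Suc k) j))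
      + (\<Sum>k\<le>M. \<Sum>l\<le>M. T (k + l) * ?d k l * (?B k l i * ?B (Suc l) k j))
      + (\<Sum>k\<le>M. \<Sum>l\<le>M. (T i - T (k + l)) * ?d k l * (?B k l i * ?B l k j)) = T i * S i"
    unfolding S_def sum_distrib_left sum.distrib[symmetric] pascal ..
  also have "S i = gauss_fps a b g $ i * gauss_fps a b g $ j"
    using Suc i by (simp add: S_def)
  also have "T i * (gauss_fps a b g $ i * gauss_fps a b g $ j)
      = (of_nat i + 1) * (g + of_nat i) * (gauss_fps a b g $ Suc i * gauss_fps a b g $ j)"
    unfolding T_def by (simp only: gauss_fps_nth_Suc[OF g, of i a b, symmetric] mult.assoc[symmetric])
  finally have eq: "(of_nat i + 1) * (g + of_nat i) * S (Suc i) = \<dots>" .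
  have nz: "(of_nat i + 1) * (g + of_nat i) \<noteq> (0 :: complex)"
    using nonpos_int_nonzero[OF g, of i] of_nat_neq_0[of i, where 'a = complex]
    by (simp add: add.commute)
  have "S (Suc i) = gauss_fps a b g $ Suc i * gauss_fps a b g $ j"
    using eq unfolding mult_left_cancel[OF nz] .
  then show ?case by (simp only: S_def)
qed

text \<open>
  As \<open>U\<close> and \<open>V\<close> have no constant term, powers beyond the \<open>n\<close>-th do not reach the \<open>n\<close>-th coefficient, so
  all sums are finite and may be exchanged freely.
\<close>

lemma compose_mult_compose_nth:
  fixes F G U V :: "complex fps"
  assumes "U $ 0 = 0" "V $ 0 = 0"
  shows "((F oo U) * (G oo V)) $ n = (\<Sum>i\<le>n. \<Sum>j\<le>n. F $ i * G $ j * (U ^ i * V ^ j) $ n)"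
proof -
  have trunc: "(H oo W) $ m = (\<Sum>i\<le>n. H $ i * (W ^ i) $ m)"
    if "m \<le> n" "W $ 0 = 0" for H W :: "complex fps" and m
    unfolding fps_compose_nth using that
    by (intro sum.mono_neutral_left) (auto simp: startsby_zero_power_prefix)
  have "((F oo U) * (G oo V)) $ n =
     (\<Sum>m\<le>n. (\<Sum>i\<le>n. F $ i * (U ^ i) $ m) * (\<Sum>j\<le>n. G $ j * (V ^ j) $ (n - m)))"
    unfolding fps_mult_nth using assms by (intro sum.cong) (auto simp: trunc)
  also have "\<dots> = (\<Sum>m\<le>n. \<Sum>i\<le>n. \<Sum>j\<le>n. F $ i * G $ j * ((U ^ i) $ m * (V ^ j) $ (n - m)))"
    unfolding sum_product by (intro sum.cong refl) (simp only: mult_ac)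
  also have "\<dots> = (\<Sum>i\<le>n. \<Sum>j\<le>n. \<Sum>m\<le>n. F $ i * G $ j * ((U ^ i) $ m * (V ^ j) $ (n - m)))"
    by (subst sum.swap, rule sum.cong[OF refl], subst sum.swap) (rule refl)
  finally show ?thesis
    unfolding fps_mult_nth[of "U ^ _"] sum_distrib_left atMost_atLeast0 .
qed

lemma monomial_fps_compose:
  fixes U :: "complex fps"
  assumes "U $ 0 = 0"
  shows "monomial_fps k l oo U = U ^ k * (1 - U) ^ l"
  unfolding monomial_fps_def fps_compose_mult_distrib[OF assms] fps_compose_power[OF assms, symmetric]
    fps_compose_sub_distrib using assms by simp

text \<open>
  Substituting series \<open>U\<close>, \<open>V\<close> in one variable for which \<open>U * (1 - V)\<close> and \<open>V * (1 - U)\<close> are linear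
  turns \<open>F\<^sub>4\<close> into a power series whose \<open>n\<close>-th coefficient collects the summands of total degree \<open>n\<close>.
  Working with formal series replaces every question of convergence of the double series, which
  need not converge absolutely everywhere in the unit disc of the final variable.
\<close>

theorem bailey_formal:
  fixes U V :: "complex fps"
  assumes g: "g \<notin> \<int>\<^sub>\<le>\<^sub>0" and ab: "a + b = 2 * g - 1"
    and UV: "U $ 0 = 0" "V $ 0 = 0"
    and p: "U * (1 - V) = fps_const p * fps_X" and q: "V * (1 - U) = fps_const q * fps_X"
  shows "((gauss_fps a b g oo U) * (gauss_fps a b g oo V)) $ n
           = (\<Sum>k\<le>n. appell_coeff a b g k (n - k) * p ^ k * q ^ (n - k))"
proof -
  let ?d = "appell_coeff a b g"
  have coeff: "((monomial_fps k l oo U) * (monomial_fps l k oo V)) $ n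
                = (if n = k + l then p ^ k * q ^ l else 0)" for k l
  proof -
    have "(monomial_fps k l oo U) * (monomial_fps l k oo V) = (U * (1 - V)) ^ k * (V * (1 - U)) ^ l"
      unfolding monomial_fps_compose[OF UV(1)] monomial_fps_compose[OF UV(2)] power_mult_distrib
      by (simp only: mult_ac)
    also have "\<dots> = fps_const (p ^ k) * fps_const (q ^ l) * fps_X ^ (k + l)"
      unfolding p q power_mult_distrib fps_const_power power_add by (simp only: mult_ac)
    finally show ?thesis by (simp add: fps_X_power_mult_right_nth)
  qed
  have "((gauss_fps a b g oo U) * (gauss_fps a b g oo V)) $ n
      = (\<Sum>i\<le>n. \<Sum>j\<le>n. (\<Sum>k\<le>n. \<Sum>l\<le>n. ?d k l * (monomial_fps k l $ i * monomial_fps l k $ j))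
            * (U ^ i * V ^ j) $ n)"
    unfolding compose_mult_compose_nth[OF UV]
    by (intro sum.cong refl) (simp add: gauss_coeff_product[OF g ab])
  also have "\<dots> = (\<Sum>i\<le>n. \<Sum>j\<le>n. \<Sum>k\<le>n. \<Sum>l\<le>n. ?d k l * (monomial_fps k l $ i * monomial_fps l k $ j * (U ^ i * V ^ j) $ n))"
    unfolding sum_distrib_right by (intro sum.cong refl) (simp only: mult_ac)
  also have "\<dots> = (\<Sum>i\<le>n. \<Sum>k\<le>n. \<Sum>l\<le>n. \<Sum>j\<le>n. ?d k l * (monomial_fps k l $ i * monomial_fps l k $ j * (U ^ i * V ^ j) $ n))"
    by (rule sum.cong[OF refl], subst sum.swap, rule sum.cong[OF refl], subst sum.swap) (rule refl)
  also have "\<dots> = (\<Sum>k\<le>n. \<Sum>l\<le>n. \<Sum>i\<le>n. \<Sum>j\<le>n. ?d k l * (monomial_fps k l $ i * monomial_fps l k $ j * (U ^ i * V ^ j) $ n))"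
    by (subst sum.swap, rule sum.cong[OF refl], subst sum.swap) (rule refl)
  also have "\<dots> = (\<Sum>k\<le>n. \<Sum>l\<le>n. ?d k l * ((monomial_fps k l oo U) * (monomial_fps l k oo V)) $ n)"
    unfolding compose_mult_compose_nth[OF UV] sum_distrib_left ..
  also have "\<dots> = (\<Sum>k\<le>n. \<Sum>l\<le>n. if l = n - k then ?d k l * p ^ k * q ^ l else 0)"
    unfolding coeff by (intro sum.cong refl) auto
  finally show ?thesis by simp
qed

section \<open>Ultraspherical polynomials\<close>

text \<open>
  The part of the Appell coefficients that does not depend on the numerator parameters.
\<close>

definition jacobi_weight :: "complex \<Rightarrow> nat \<Rightarrow> nat \<Rightarrow> complex" where
  "jacobi_weight g k l = 1 / (pochhammer g k * pochhammer g l * fact k * fact l)"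

lemma appell_coeff_eq_jacobi_weight:
  "appell_coeff a b g k l = pochhammer a (k + l) * pochhammer b (k + l) * jacobi_weight g k l"
  by (simp add: appell_coeff_def jacobi_weight_def)

lemma jacobi_weight_Suc:
  assumes g: "g \<notin> \<int>\<^sub>\<le>\<^sub>0"
  shows "of_nat (Suc k) * (of_nat k + g) * jacobi_weight g (Suc k) l = jacobi_weight g k l"
    and "of_nat (Suc l) * (of_nat l + g) * jacobi_weight g k (Suc l) = jacobi_weight g k l"
proof -
  have nz: "of_nat (Suc m) \<noteq> (0 :: complex)" for m by (rule of_nat_neq_0)
  show "of_nat (Suc k) * (of_nat k + g) * jacobi_weight g (Suc k) l = jacobi_weight g k l"
    using nz[of k] nonpos_int_nonzero[OF g, of k]
    by (simp add: jacobi_weight_def pochhammer_Suc divide_simps add.commute del: of_nat_Suc)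
  show "of_nat (Suc l) * (of_nat l + g) * jacobi_weight g k (Suc l) = jacobi_weight g k l"
    using nz[of l] nonpos_int_nonzero[OF g, of l]
    by (simp add: jacobi_weight_def pochhammer_Suc divide_simps add.commute del: of_nat_Suc)
qed

text \<open>
  The symmetric form of the ultraspherical polynomial in \<open>X = (1 - x) / 2\<close> and
  \<open>1 - X = (1 + x) / 2\<close>. Applying the operator to the sum, the two families of lowered monomials
  cancel because of the alternating sign; what remains is the hypergeometric equation with
  \<open>a = - N\<close> and \<open>b = N + 2 * g - 1\<close>.
\<close>

lemma gauss_fps_terminating:
  assumes g: "g \<notin> \<int>\<^sub>\<le>\<^sub>0"
  shows "(\<Sum>k\<le>N. fps_const ((- 1) ^ k * jacobi_weight g k (N - k)) * monomial_fps k (N - k))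
           = fps_const (jacobi_weight g 0 N) * gauss_fps (- of_nat N) (of_nat N + (2 * g - 1)) g"
proof -
  define c where "c = (\<lambda>k. (- 1) ^ k * jacobi_weight g k (N - k))"
  define J where "J = (\<Sum>k\<le>N. fps_const (c k) * monomial_fps k (N - k))"
  have J_nth: "J $ i = (\<Sum>k\<le>N. c k * monomial_fps k (N - k) $ i)" for i
    by (simp add: J_def fps_sum_nth)
  have rec: "(of_nat i + 1) * (g + of_nat i) * J $ Suc i
      = (- of_nat N + of_nat i) * (of_nat N + (2 * g - 1) + of_nat i) * J $ i" for i
  proof -
    let ?L = "\<Sum>k\<le>N. c k * (of_nat k * (of_nat k - 1 + g) * monomial_fps (k - 1) (N - k) $ i)"
    let ?R = "\<Sum>k\<le>N. c k * (of_nat (N - k) * (of_nat (N - k) - 1 + g) * monomial_fps k (N - k - 1) $ i)"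
    have cancel: "?L + ?R = 0"
    proof (cases N)
      case (Suc M)
      have "?L = (\<Sum>k\<le>M. c (Suc k) * (of_nat (Suc k) * (of_nat k + g) * monomial_fps k (M - k) $ i))"
        unfolding Suc sum.atMost_Suc_shift by simp
      also have "\<dots> = (\<Sum>k\<le>M. - ((- 1) ^ k * jacobi_weight g k (M - k) * monomial_fps k (M - k) $ i))"
      proof (intro sum.cong refl)
        fix k assume "k \<in> {..M}"
        then have "c (Suc k) * (of_nat (Suc k) * (of_nat k + g) * monomial_fps k (M - k) $ i)
          = - ((- 1) ^ k * (of_nat (Suc k) * (of_nat k + g) * jacobi_weight g (Suc k) (M - k))
               * monomial_fps k (M - k) $ i)"
          by (simp add: c_def Suc del: of_nat_Suc)
        then show "c (Suc k) * (of_nat (Suc k) * (of_nat k + g) * monomial_fps k (M - k) $ i)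
          = - ((- 1) ^ k * jacobi_weight g k (M - k) * monomial_fps k (M - k) $ i)"
          by (simp only: jacobi_weight_Suc[OF g])
      qed
      finally have L: "?L = (\<Sum>k\<le>M. - ((- 1) ^ k * jacobi_weight g k (M - k) * monomial_fps k (M - k) $ i))" .
      have "?R = (\<Sum>k\<le>M. c k * (of_nat (N - k) * (of_nat (N - k) - 1 + g) * monomial_fps k (N - k - 1) $ i))"
        by (simp add: Suc)
      also have "\<dots> = (\<Sum>k\<le>M. (- 1) ^ k * jacobi_weight g k (M - k) * monomial_fps k (M - k) $ i)"
      proof (intro sum.cong refl)
        fix k assume "k \<in> {..M}"
        then have N: "N - k = Suc (M - k)" using Suc by simp
        have "c k * (of_nat (N - k) * (of_nat (N - k) - 1 + g) * monomial_fps k (N - k - 1) $ i)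
          = (- 1) ^ k * (of_nat (Suc (M - k)) * (of_nat (M - k) + g) * jacobi_weight g k (Suc (M - k)))
               * monomial_fps k (M - k) $ i"
          unfolding c_def N by simp
        then show "c k * (of_nat (N - k) * (of_nat (N - k) - 1 + g) * monomial_fps k (N - k - 1) $ i)
          = (- 1) ^ k * jacobi_weight g k (M - k) * monomial_fps k (M - k) $ i"
          by (simp only: jacobi_weight_Suc[OF g])
      qed
      finally show ?thesis unfolding L by (simp add: sum_negf)
    qed simp
    have N: "of_nat k + of_nat (N - k) = (of_nat N :: complex)" if "k \<le> N" for k
      using that by (simp flip: of_nat_add)
    have "(of_nat i + 1) * (g + of_nat i) * J $ Suc i
      = (\<Sum>k\<le>N. c k * ((of_nat i + 1) * (g + of_nat i) * monomial_fps k (N - k) $ Suc i))"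
      unfolding J_nth sum_distrib_left by (intro sum.cong refl) (simp only: mult_ac)
    also have "\<dots> = ?L + ?R + (\<Sum>k\<le>N. c k * ((of_nat i * (of_nat i - 1 + 2 * g)
          - of_nat N * (of_nat N - 1 + 2 * g)) * monomial_fps k (N - k) $ i))"
      unfolding monomial_fps_nth_Suc sum.distrib[symmetric]
      by (intro sum.cong refl) (simp add: N ring_distribs)
    also have "\<dots> = (of_nat i * (of_nat i - 1 + 2 * g) - of_nat N * (of_nat N - 1 + 2 * g)) * J $ i"
      unfolding cancel J_nth sum_distrib_left by (simp add: mult.left_commute)
    also have "of_nat i * (of_nat i - 1 + 2 * g) - of_nat N * (of_nat N - 1 + 2 * g)
       = (- of_nat N + of_nat i) * (of_nat N + (2 * g - 1) + of_nat i)"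
      by (simp add: algebra_simps)
    finally show ?thesis .
  qed
  have "J $ 0 = (\<Sum>k\<le>N. if k = 0 then c k else 0)"
    unfolding J_nth by (intro sum.cong refl) (simp add: monomial_fps_nth_0)
  then have "J $ 0 = jacobi_weight g 0 N" by (simp add: c_def)
  with gauss_fps_unique[OF g rec] show ?thesis by (simp add: J_def c_def)
qed

text \<open>
  Passing through polynomials makes the evaluation valid at every \<open>s\<close>, in particular at \<open>s = 1\<close>, on
  the boundary of the disc.
\<close>

lemma eval_fps_monomial_sum:
  "eval_fps (\<Sum>k\<in>A. fps_const (c k) * monomial_fps k (l k)) s = (\<Sum>k\<in>A. c k * s ^ k * (1 - s) ^ l k)"
proof -
  have "monomial_fps k l = fps_of_poly (monom 1 k * [:1, - 1:] ^ l)" for k l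
    by (simp add: monomial_fps_def fps_of_poly_mult fps_of_poly_power fps_of_poly_monom' fps_of_poly_pCons)
  then have "(\<Sum>k\<in>A. fps_const (c k) * monomial_fps k (l k))
      = fps_of_poly (\<Sum>k\<in>A. smult (c k) (monom 1 k * [:1, - 1:] ^ l k))"
    by (simp add: fps_of_poly_sum fps_of_poly_smult)
  then show ?thesis
    by (simp add: poly_sum poly_monom mult.assoc)
qed

lemma gegenbauer_expansion:
  assumes g: "\<mu> + 1 / 2 \<notin> \<int>\<^sub>\<le>\<^sub>0"
  shows "gegenbauer n \<mu> x = pochhammer (2 * \<mu>) n * pochhammer (\<mu> + 1 / 2) n *
     (\<Sum>k\<le>n. jacobi_weight (\<mu> + 1 / 2) k (n - k) * (- ((1 - x) / 2)) ^ k * (1 - (1 - x) / 2) ^ (n - k))"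
proof -
  let ?g = "\<mu> + 1 / 2" and ?s = "(1 - x) / 2"
  let ?F = "gauss_fps (- of_nat n) (of_nat n + 2 * \<mu>) ?g"
  have zero: "?F $ m = 0" if "m > n" for m
    using that by (simp add: gauss_fps_def pochhammer_of_nat_eq_0_lemma)
  have "summable (\<lambda>m. ?F $ m * ?s ^ m)"
    by (rule summable_finite[of "{..n}"]) (auto simp: zero)
  then have hyp: "hyp2F1 (- of_nat n) (of_nat n + 2 * \<mu>) ?g ?s = eval_fps ?F ?s"
    by (rule hyp2F1_eq_eval_fps)
  have w: "jacobi_weight ?g 0 n \<noteq> 0" "1 / fact n / jacobi_weight ?g 0 n = pochhammer ?g n"
    using pochhammer_nonzero[OF g, of n] by (simp_all add: jacobi_weight_def)
  have F: "?F = fps_const (1 / jacobi_weight ?g 0 n) *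
      (\<Sum>k\<le>n. fps_const ((- 1) ^ k * jacobi_weight ?g k (n - k)) * monomial_fps k (n - k))"
    unfolding gauss_fps_terminating[OF g] using w(1) by (simp add: algebra_simps)
  have "eval_fps ?F ?s = (\<Sum>k\<le>n. (1 / jacobi_weight ?g 0 n * ((- 1) ^ k * jacobi_weight ?g k (n - k)))
           * ?s ^ k * (1 - ?s) ^ (n - k))"
    unfolding F eval_fps_monomial_sum[symmetric] sum_distrib_left mult.assoc[symmetric] fps_const_mult ..
  also have "\<dots> = 1 / jacobi_weight ?g 0 n *
      (\<Sum>k\<le>n. jacobi_weight ?g k (n - k) * (- ?s) ^ k * (1 - ?s) ^ (n - k))"
    unfolding sum_distrib_left by (intro sum.cong refl) (simp add: power_minus[of ?s] mult_ac)
  finally have eval: "eval_fps ?F ?s = \<dots>" .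
  have "P / f * (1 / w * S) = P * (1 / f / w) * S" for P f w S :: complex by simp
  then show ?thesis
    unfolding gegenbauer_def hyp eval w(2)[symmetric] .
qed

section \<open>Brafman's generating function in the unit disc\<close>

text \<open>
  The roots of this quadratic are \<open>(1 - r \<mp> R) / 2\<close> for a square root \<open>R\<close>, and one of them may leave
  the disc; the sign of \<open>Re R\<close> selects the right one. If \<open>norm u \<ge> 1\<close>, then \<open>norm r < 1\<close> forces
  \<open>Re u > s\<close>, because \<open>(norm (u - s))\<^sup>2 - (norm (u * (1 - u)))\<^sup>2 = (s - N) * (s + N - 2 * Re u)\<close> for
  \<open>N = (norm u)\<^sup>2\<close>. On the other hand, solving for \<open>r\<close> expresses \<open>R\<close> through \<open>u\<close>, and then \<open>Re R\<close> is
  nonpositive.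
\<close>

lemma quadratic_root_in_disc:
  fixes r u :: complex and s :: real
  assumes r: "norm r < 1" and s: "0 \<le> s" "s \<le> 1"
    and root: "u\<^sup>2 - (1 - r) * u - r * of_real s = 0" and branch: "Re (1 - r - 2 * u) > 0"
  shows "norm u < 1"
proof (rule ccontr)
  assume "\<not> norm u < 1"
  define p y N where "p = Re u" and "y = Im u" and "N = (norm u)\<^sup>2"
  have N: "N = p\<^sup>2 + y\<^sup>2" by (simp add: N_def p_def y_def cmod_power2)
  have "N \<ge> 1" using \<open>\<not> norm u < 1\<close> by (simp add: N_def)
  have ru: "r * (u - of_real s) = u * (1 - u)"
    using root by (simp add: algebra_simps power2_eq_square)
  have "u \<noteq> of_real s"
  proof
    assume us: "u = of_real s"
    then have "u = 0 \<or> u = 1" using ru by auto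
    with \<open>\<not> norm u < 1\<close> have "u = 1" by auto
    with branch have "Re r < - 1" by simp
    with r abs_Re_le_cmod[of r] show False by linarith
  qed
  then have pos: "norm (u - of_real s) > 0" by simp
  have "norm u * norm (1 - u) = norm r * norm (u - of_real s)"
    using ru by (metis norm_mult)
  also have "\<dots> < norm (u - of_real s)" using r pos by simp
  finally have "(norm u * norm (1 - u))\<^sup>2 < (norm (u - of_real s))\<^sup>2"
    by (intro power_strict_mono) auto
  then have "N * ((1 - p)\<^sup>2 + y\<^sup>2) < (p - s)\<^sup>2 + y\<^sup>2"
    by (simp add: power_mult_distrib N_def cmod_power2 p_def y_def)
  then have "(s - N) * (s + N - 2 * p) > 0"
    unfolding N by (simp add: algebra_simps power2_eq_square)
  then have p: "s + N < 2 * p"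
    using \<open>N \<ge> 1\<close> s by (simp add: zero_less_mult_iff)
  have Re_mult_real: "Re (w * of_real c) = Re w * c" for w c by simp
  \<comment> \<open>eliminate r, then clear the denominator by the conjugate\<close>
  have "(1 - r - 2 * u) * (u - of_real s) = - u\<^sup>2 + 2 * u * of_real s - of_real s"
    using ru by (simp add: algebra_simps power2_eq_square)
  then have "(1 - r - 2 * u) * ((u - of_real s) * cnj (u - of_real s))
      = (- u\<^sup>2 + 2 * u * of_real s - of_real s) * cnj (u - of_real s)"
    by (metis mult.assoc)
  then have "(1 - r - 2 * u) * of_real ((norm (u - of_real s))\<^sup>2)
      = (- u\<^sup>2 + 2 * u * of_real s - of_real s) * cnj (u - of_real s)"
    by (simp only: complex_norm_square)
  then have "Re (1 - r - 2 * u) * (norm (u - of_real s))\<^sup>2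
      = Re ((- u\<^sup>2 + 2 * u * of_real s - of_real s) * cnj (u - of_real s))"
    by (metis Re_mult_real)
  moreover have "Re (1 - r - 2 * u) * (norm (u - of_real s))\<^sup>2 > 0"
    using branch pos by simp
  moreover have "Re ((- u\<^sup>2 + 2 * u * of_real s - of_real s) * cnj (u - of_real s))
      = N * (s - p) + 2 * s * p\<^sup>2 - s * p - 2 * s\<^sup>2 * p + s\<^sup>2"
    unfolding N by (simp add: p_def y_def algebra_simps power2_eq_square)
  ultimately have "N * (s - p) + 2 * s * p\<^sup>2 - s * p - 2 * s\<^sup>2 * p + s\<^sup>2 > 0"
    by simp
  \<comment> \<open>the expression is affine in N with negative slope, and \<open>N \<ge> p\<^sup>2\<close>\<close>
  moreover have "p > s" using p s \<open>N \<ge> 1\<close> by linarith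
  then have "N * (s - p) \<le> p\<^sup>2 * (s - p)"
    by (intro mult_right_mono_neg) (auto simp: N)
  moreover have "p\<^sup>2 * (s - p) + 2 * s * p\<^sup>2 - s * p - 2 * s\<^sup>2 * p + s\<^sup>2
      = - ((p - s) * ((p - s)\<^sup>2 + s * (1 - s)))"
    by (simp add: algebra_simps power2_eq_square)
  moreover have "(p - s) * ((p - s)\<^sup>2 + s * (1 - s)) \<ge> 0"
    using \<open>p > s\<close> s by (intro mult_nonneg_nonneg add_nonneg_nonneg) auto
  ultimately show False by linarith
qed

text \<open>
  The radicand is \<open>(1 - r * exp (\<i> * \<theta>)) * (1 - r * exp (- \<i> * \<theta>))\<close> with \<open>x = cos \<theta>\<close>, a product of
  two numbers in the right half-plane. So the principal square root is holomorphic in \<open>r\<close>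
  throughout the disc.
\<close>

lemma generating_radicand_off_cut:
  fixes r :: complex and x :: real
  assumes r: "norm r < 1" and x: "\<bar>x\<bar> \<le> 1"
  shows "1 + r\<^sup>2 - 2 * r * of_real x \<notin> \<real>\<^sub>\<le>\<^sub>0"
proof
  assume "1 + r\<^sup>2 - 2 * r * of_real x \<in> \<real>\<^sub>\<le>\<^sub>0"
  then have re: "1 + ((Re r)\<^sup>2 - (Im r)\<^sup>2) - 2 * Re r * x \<le> 0" and im: "Im r * (Re r - x) = 0"
    by (auto simp: complex_nonpos_Reals_iff power2_eq_square algebra_simps)
  have n: "(Re r)\<^sup>2 + (Im r)\<^sup>2 < 1"
    using r by (metis cmod_power2 norm_ge_zero power_less_one_iff zero_neq_numeral abs_norm_cancel abs_square_less_1)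
  show False
  proof (cases "Im r = 0")
    case True
    have "\<bar>Re r * x\<bar> \<le> \<bar>Re r\<bar>" using x by (simp add: abs_mult mult_left_le)
    then have "1 + (Re r)\<^sup>2 - 2 * Re r * x \<ge> (1 - \<bar>Re r\<bar>)\<^sup>2"
      by (simp add: power2_diff)
    moreover have "\<bar>Re r\<bar> < 1" using r abs_Re_le_cmod[of r] by linarith
    then have "(1 - \<bar>Re r\<bar>)\<^sup>2 > 0" by simp
    moreover have "1 + (Re r)\<^sup>2 - 2 * Re r * x \<le> 0" using re True by simp
    ultimately show False by linarith
  next
    case False
    then have "x = Re r" using im by simp
    with re n show False by (simp add: power2_eq_square)
  qed
qed

lemma Re_csqrt_pos:
  assumes "w \<notin> \<real>\<^sub>\<le>\<^sub>0"
  shows "Re (csqrt w) > 0"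
proof (rule ccontr)
  assume "\<not> Re (csqrt w) > 0"
  then have "Re (csqrt w) = 0" using csqrt_principal[of w] by auto
  then have "Re ((csqrt w)\<^sup>2) \<le> 0" "Im ((csqrt w)\<^sup>2) = 0"
    by (simp_all add: power2_eq_square)
  with assms show False by (simp add: complex_nonpos_Reals_iff)
qed

text \<open>
  Brafman's generating function for ultraspherical polynomials. The product of the two
  hypergeometric functions is holomorphic in the whole unit disc of the variable \<open>r\<close>, since the
  two arguments stay in the unit disc. Hence its Taylor series converges there, and the Taylor
  coefficients are known from the formal identity.
\<close>

theorem brafman_ultraspherical:
  fixes a b g r :: complex and x :: real
  defines "s \<equiv> complex_of_real ((1 - x) / 2)" and "R \<equiv> csqrt (1 + r\<^sup>2 - 2 * r * of_real x)"
  assumes g: "g \<notin> \<int>\<^sub>\<le>\<^sub>0" and ab: "a + b = 2 * g - 1"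
    and x: "\<bar>x\<bar> \<le> 1" and r: "norm r < 1"
  shows "norm ((1 - R - r) / 2) < 1" and "norm ((1 - R + r) / 2) < 1"
    and "(\<lambda>n. (\<Sum>k\<le>n. appell_coeff a b g k (n - k) * (- s) ^ k * (1 - s) ^ (n - k)) * r ^ n)
           sums (eval_fps (gauss_fps a b g) ((1 - R - r) / 2) * eval_fps (gauss_fps a b g) ((1 - R + r) / 2))"
proof -
  define rad where "rad = (\<lambda>z. csqrt (1 + z\<^sup>2 - 2 * z * of_real x))"
  define u v where "u = (\<lambda>z. (1 - rad z - z) / 2)" and "v = (\<lambda>z. (1 - rad z + z) / 2)"
  let ?F = "eval_fps (gauss_fps a b g)"
  have rad2: "rad z * rad z = 1 + z * z - 2 * z * of_real x" for z
    using power2_csqrt[of "1 + z\<^sup>2 - 2 * z * of_real x"] by (simp add: rad_def power2_eq_square)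
  have s1: "1 - s = complex_of_real ((1 + x) / 2)" by (simp add: s_def field_simps)
  have uv: "u z * (1 - v z) = - s * z" for z
  proof -
    have "u z * (1 - v z) = (1 - 2 * z + z * z - rad z * rad z) / 4"
      by (simp add: u_def v_def field_simps)
    also have "\<dots> = - s * z" unfolding rad2 by (simp add: s_def field_simps)
    finally show ?thesis .
  qed
  have vu: "v z * (1 - u z) = (1 - s) * z" for z
  proof -
    have "v z * (1 - u z) = (1 + 2 * z + z * z - rad z * rad z) / 4"
      by (simp add: u_def v_def field_simps)
    also have "\<dots> = (1 - s) * z" unfolding rad2 s1 by (simp add: field_simps)
    finally show ?thesis .
  qed
  have rad_pos: "Re (rad z) > 0" if "norm z < 1" for z
    using generating_radicand_off_cut[OF that x] unfolding rad_def by (rule Re_csqrt_pos)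
  have u1: "norm (u z) < 1" if "norm z < 1" for z
  proof (rule quadratic_root_in_disc[OF that])
    have "(u z)\<^sup>2 - (1 - z) * u z - z * of_real ((1 - x) / 2)
        = (rad z * rad z - (1 + z * z - 2 * z * of_real x)) / 4"
      by (simp add: u_def field_simps power2_eq_square)
    then show "(u z)\<^sup>2 - (1 - z) * u z - z * of_real ((1 - x) / 2) = 0"
      by (simp only: rad2) simp
    show "Re (1 - z - 2 * u z) > 0" using rad_pos[OF that] by (simp add: u_def)
  qed (use x in auto)
  have v1: "norm (v z) < 1" if "norm z < 1" for z
  proof (rule quadratic_root_in_disc[of "- z"])
    have "(v z)\<^sup>2 - (1 - - z) * v z - - z * of_real ((1 + x) / 2)
        = (rad z * rad z - (1 + z * z - 2 * z * of_real x)) / 4"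
      by (simp add: v_def field_simps power2_eq_square)
    then show "(v z)\<^sup>2 - (1 - - z) * v z - - z * of_real ((1 + x) / 2) = 0"
      by (simp only: rad2) simp
    show "Re (1 - - z - 2 * v z) > 0" using rad_pos[OF that] by (simp add: v_def)
  qed (use x that in auto)
  show "norm ((1 - R - r) / 2) < 1" "norm ((1 - R + r) / 2) < 1"
    using u1[OF r] v1[OF r] by (simp_all add: u_def v_def rad_def R_def)

  have hol: "u holomorphic_on ball 0 1" "v holomorphic_on ball 0 1"
    unfolding u_def v_def rad_def using generating_radicand_off_cut[OF _ x]
    by (auto intro!: holomorphic_intros)
  have holF: "?F holomorphic_on ball 0 1"
    by (rule holomorphic_on_eval_fps) (use less_fps_conv_radius_gauss[OF g] in auto)
  have holG: "(\<lambda>z. ?F (u z) * ?F (v z)) holomorphic_on ball 0 1"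
  proof (rule holomorphic_on_mult)
    have "u ` ball 0 1 \<subseteq> ball 0 1" "v ` ball 0 1 \<subseteq> ball 0 1" using u1 v1 by auto
    then show "(\<lambda>z. ?F (u z)) holomorphic_on ball 0 1" "(\<lambda>z. ?F (v z)) holomorphic_on ball 0 1"
      using holomorphic_on_compose_gen[OF hol(1) holF] holomorphic_on_compose_gen[OF hol(2) holF]
      by (simp_all add: o_def)
  qed

  define U V where "U = fps_expansion u 0" and "V = fps_expansion v 0"
  have "0 \<in> ball (0 :: complex) 1" by simp
  then have "u analytic_on {0}" "v analytic_on {0}"
    using hol by (auto simp: analytic_at intro!: exI[of _ "ball 0 1"])
  then have U: "u has_fps_expansion U" and V: "v has_fps_expansion V"
    unfolding U_def V_def by (simp_all add: analytic_at_imp_has_fps_expansion_0)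
  have zero: "U $ 0 = 0" "V $ 0 = 0"
    using has_fps_expansion_imp_0_eq_fps_nth_0[OF U] has_fps_expansion_imp_0_eq_fps_nth_0[OF V]
    by (simp_all add: u_def v_def rad_def)
  have lin: "(\<lambda>z. c * z) has_fps_expansion fps_const c * fps_X" for c :: complex
    by (intro fps_expansion_intros)
  have "(\<lambda>z. u z * (1 - v z)) has_fps_expansion U * (1 - V)"
    by (intro fps_expansion_intros U V)
  then have p: "U * (1 - V) = fps_const (- s) * fps_X"
    unfolding uv using lin by (rule fps_expansion_unique_complex)
  have "(\<lambda>z. v z * (1 - u z)) has_fps_expansion V * (1 - U)"
    by (intro fps_expansion_intros U V)
  then have q: "V * (1 - U) = fps_const (1 - s) * fps_X"
    unfolding vu using lin by (rule fps_expansion_unique_complex)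
  have "fps_conv_radius (gauss_fps a b g) > 0"
    using gauss_fps_conv_radius[OF g, of a b] by (rule less_le_trans[rotated]) simp
  then have F: "?F has_fps_expansion gauss_fps a b g"
    by (rule eval_fps_has_fps_expansion)
  have "(\<lambda>z. (?F \<circ> u) z * (?F \<circ> v) z) has_fps_expansion
          (gauss_fps a b g oo U) * (gauss_fps a b g oo V)"
    by (intro has_fps_expansion_mult has_fps_expansion_compose F U V zero)
  then have "(\<lambda>z. ?F (u z) * ?F (v z)) has_fps_expansion
          (gauss_fps a b g oo U) * (gauss_fps a b g oo V)"
    by (simp add: o_def)
  then have "(\<lambda>n. ((gauss_fps a b g oo U) * (gauss_fps a b g oo V)) $ n * r ^ n) sums (?F (u r) * ?F (v r))"
    by (rule has_fps_expansion_imp_sums_complex[where r = 1]) (use holG r in auto)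
  then show "(\<lambda>n. (\<Sum>k\<le>n. appell_coeff a b g k (n - k) * (- s) ^ k * (1 - s) ^ (n - k)) * r ^ n)
           sums (?F ((1 - R - r) / 2) * ?F ((1 - R + r) / 2))"
    unfolding bailey_formal[OF g ab zero p q] by (simp add: u_def v_def rad_def R_def)
qed

section \<open>Legendre and Ferrers functions\<close>

text \<open>
  Multiplying the algebraic factor of a Legendre function by the one from Euler's transformation
  leaves a symmetric expression: for \<open>p = z + 1\<close>, \<open>w = z - 1\<close> it is a power of \<open>z\<^sup>2 - 1\<close>, and for
  \<open>p = 1 + y\<close>, \<open>w = 1 - y\<close> a power of \<open>1 - y\<^sup>2\<close>.
\<close>

lemma legendre_prefactor:
  fixes p w \<mu> :: real
  assumes "p > 0" "w > 0"
  shows "complex_of_real (p / w) powr (complex_of_real (1 / 2 - \<mu>) / 2)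
           * complex_of_real (p / 2) powr complex_of_real (\<mu> - 1 / 2)
         = complex_of_real ((w * p / 4) powr (\<mu> / 2 - 1 / 4))"
proof -
  define \<kappa> where "\<kappa> = \<mu> / 2 - 1 / 4"
  have cpowr: "complex_of_real (p / w) powr complex_of_real (- \<kappa>) = complex_of_real ((p / w) powr (- \<kappa>))"
    "complex_of_real (p / 2) powr complex_of_real (2 * \<kappa>) = complex_of_real ((p / 2) powr (2 * \<kappa>))"
    using assms by (auto intro!: powr_of_real simp del: of_real_divide of_real_minus of_real_mult)
  have exps: "complex_of_real (1 / 2 - \<mu>) / 2 = complex_of_real (- \<kappa>)"
    "complex_of_real (\<mu> - 1 / 2) = complex_of_real (2 * \<kappa>)"
    by (simp_all add: \<kappa>_def)
  have "(p / w) powr (- \<kappa>) = (w / p) powr \<kappa>"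
    using assms by (simp add: powr_minus powr_divide divide_simps)
  moreover have "(p / 2) powr (2 * \<kappa>) = ((p / 2)\<^sup>2) powr \<kappa>"
  proof -
    have "(p / 2)\<^sup>2 = (p / 2) powr 2" using assms by simp
    then show ?thesis by (simp only: powr_powr)
  qed
  moreover have "(w / p) powr \<kappa> * ((p / 2)\<^sup>2) powr \<kappa> = (w / p * (p / 2)\<^sup>2) powr \<kappa>"
    using assms by (subst powr_mult) auto
  moreover have "w / p * (p / 2)\<^sup>2 = w * p / 4"
    using assms by (simp add: power2_eq_square field_simps)
  ultimately have real: "(p / w) powr (- \<kappa>) * (p / 2) powr (2 * \<kappa>) = (w * p / 4) powr \<kappa>"
    by (simp only:)
  show ?thesis
    unfolding exps cpowr of_real_mult[symmetric] real unfolding \<kappa>_def ..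
qed

text \<open>
  With \<open>A = (z\<^sup>2 - 1) / 4\<close>, \<open>B = (1 - y\<^sup>2) / 4\<close> and \<open>T = 1 - t\<^sup>2\<close>, this shows that the dependence of the
  prefactors on \<open>t\<close> cancels.
\<close>

lemma legendre_product_prefactor:
  fixes A B T \<rho> \<mu> :: real
  assumes pos: "A > 0" "B > 0" "T > 0" "\<rho> > 0" and AB: "A * B = (\<rho> / 2)\<^sup>2 * T"
  shows "T powr (1 / 4 - \<mu> / 2) * (A powr (\<mu> / 2 - 1 / 4) * B powr (\<mu> / 2 - 1 / 4))
           = \<rho> powr (\<mu> - 1 / 2) * 2 powr (1 / 2 - \<mu>)"
proof -
  define \<kappa> where "\<kappa> = \<mu> / 2 - 1 / 4"
  have exps: "1 / 4 - \<mu> / 2 = - \<kappa>" "\<mu> - 1 / 2 = 2 * \<kappa>" "1 / 2 - \<mu> = - (2 * \<kappa>)"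
    by (simp_all add: \<kappa>_def)
  have "A powr \<kappa> * B powr \<kappa> = (A * B) powr \<kappa>"
    using pos by (simp add: powr_mult)
  also have "\<dots> = ((\<rho> / 2)\<^sup>2) powr \<kappa> * T powr \<kappa>"
    unfolding AB by (rule powr_mult)
  also have "((\<rho> / 2)\<^sup>2) powr \<kappa> = (\<rho> / 2) powr (2 * \<kappa>)"
  proof -
    have "(\<rho> / 2)\<^sup>2 = (\<rho> / 2) powr 2" using pos by simp
    then show ?thesis by (simp only: powr_powr)
  qed
  finally have "T powr (- \<kappa>) * (A powr \<kappa> * B powr \<kappa>) = (\<rho> / 2) powr (2 * \<kappa>) * (T powr \<kappa> * T powr (- \<kappa>))"
    by (simp only: mult_ac)
  also have "T powr \<kappa> * T powr (- \<kappa>) = 1"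
    using pos by (simp flip: powr_add)
  also have "(\<rho> / 2) powr (2 * \<kappa>) = \<rho> powr (2 * \<kappa>) * 2 powr (- (2 * \<kappa>))"
    unfolding powr_divide powr_minus by (rule divide_inverse)
  finally show ?thesis
    unfolding exps \<kappa>_def[symmetric] by simp
qed

lemma hyp2F1_euler:
  assumes c: "c \<notin> \<int>\<^sub>\<le>\<^sub>0" and z: "norm z < 1"
  shows "hyp2F1 a b c z = (1 - z) powr (c - a - b) * eval_fps (gauss_fps (c - a) (c - b) c) z"
proof -
  have "hyp2F1 a b c z = eval_fps (gauss_fps a b c) z"
    by (intro hyp2F1_eq_eval_fps summable_fps less_fps_conv_radius_gauss assms)
  also note euler_transformation[OF assms]
  finally show ?thesis .
qed

text \<open>
  These bounds place \<open>R + \<rho>\<close> in \<open>[1, 1 + 2 * \<rho>]\<close> and \<open>R - \<rho>\<close> in \<open>[1 - 2 * \<rho>, 1]\<close>, so that the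
  hypergeometric arguments lie in the unit disc; strictness for \<open>\<bar>t\<bar> < 1\<close> keeps the algebraic
  prefactors away from \<open>z = 1\<close> and \<open>y = 1\<close>.
\<close>

lemma generating_function_bounds:
  fixes \<rho> t :: real
  defines "R \<equiv> sqrt (1 + \<rho>\<^sup>2 - 2 * \<rho> * t)"
  assumes \<rho>: "0 < \<rho>" "\<rho> < 1" and t: "\<bar>t\<bar> \<le> 1"
  shows "R\<^sup>2 = 1 + \<rho>\<^sup>2 - 2 * \<rho> * t" and "1 - \<rho> \<le> R" and "R \<le> 1 + \<rho>"
    and "\<bar>t\<bar> < 1 \<Longrightarrow> 1 - \<rho> < R" and "\<bar>t\<bar> < 1 \<Longrightarrow> R < 1 + \<rho>"
proof -
  have up: "\<rho> * t \<le> \<rho>" "- \<rho> \<le> \<rho> * t"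
    using mult_left_mono[of t 1 \<rho>] mult_left_mono[of "- 1" t \<rho>] \<rho> t by auto
  have lo: "(1 - \<rho>)\<^sup>2 \<le> 1 + \<rho>\<^sup>2 - 2 * \<rho> * t" and hi: "1 + \<rho>\<^sup>2 - 2 * \<rho> * t \<le> (1 + \<rho>)\<^sup>2"
    using up by (simp_all add: power2_diff power2_sum)
  have "0 \<le> 1 + \<rho>\<^sup>2 - 2 * \<rho> * t" by (rule order_trans[OF zero_le_power2 lo])
  then show "R\<^sup>2 = 1 + \<rho>\<^sup>2 - 2 * \<rho> * t" by (simp add: R_def)
  show "1 - \<rho> \<le> R" unfolding R_def using lo by (rule real_le_rsqrt)
  show "R \<le> 1 + \<rho>" unfolding R_def using hi \<rho> by (intro real_le_lsqrt) auto
  {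
    assume t1: "\<bar>t\<bar> < 1"
    then have "\<rho> * t < \<rho>" "- \<rho> < \<rho> * t"
      using mult_strict_left_mono[of t 1 \<rho>] mult_strict_left_mono[of "- 1" t \<rho>] \<rho> by auto
    then have "(1 - \<rho>)\<^sup>2 < 1 + \<rho>\<^sup>2 - 2 * \<rho> * t" "1 + \<rho>\<^sup>2 - 2 * \<rho> * t < (1 + \<rho>)\<^sup>2"
      by (simp_all add: power2_diff power2_sum)
    then show "1 - \<rho> < R" "R < 1 + \<rho>"
      unfolding R_def using \<rho> by (auto intro: real_less_rsqrt real_less_lsqrt)
  }
qed

text \<open>
  For \<open>\<bar>t\<bar> < 1\<close> the left-hand side is a constant times the product \<open>G t\<close> of hypergeometric values.
  As \<open>G\<close> is continuous on the closed interval and the series equals \<open>G x\<close> there too, the endpoint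
  limits follow.
\<close>

theorem theorem2:
  fixes lam :: complex and \<mu> \<rho> x :: real
  assumes "\<mu> > - 1 / 2" and "\<mu> \<noteq> 0"
    and "0 < \<rho>" and "\<rho> < 1"
    and "- 1 \<le> x" and "x \<le> 1"
  shows
    "let R = (\<lambda>t::real. sqrt (1 + \<rho>\<^sup>2 - 2 * \<rho> * t));
         \<nu> = complex_of_real \<mu> - lam - 1 / 2;
         m = complex_of_real (1 / 2 - \<mu>);
         lhs = (\<lambda>t::real. complex_of_real ((1 - t\<^sup>2) powr (1 / 4 - \<mu> / 2)) *
                  legendre_P \<nu> m (complex_of_real (R t + \<rho>)) *
                  ferrers_P \<nu> m (R t - \<rho>));
         term = (\<lambda>n::nat. pochhammer lam n * pochhammer (2 * complex_of_real \<mu> - lam) n /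
                  (pochhammer (2 * complex_of_real \<mu>) n *
                   complex_of_real (Gamma (\<mu> + 1 / 2 + real n))) *
                  complex_of_real (\<rho> powr (\<mu> - 1 / 2 + real n)) *
                  gegenbauer n (complex_of_real \<mu>) (complex_of_real x));
         rhs = complex_of_real (2 powr (1 / 2 - \<mu>) / Gamma (\<mu> + 1 / 2)) * (\<Sum>n. term n)
     in summable term \<and>
        (if \<bar>x\<bar> < 1 then lhs x = rhs
         else (lhs \<longlongrightarrow> rhs) (at x within {-1<..<1}))"
proof -
  define R where "R = (\<lambda>t::real. sqrt (1 + \<rho>\<^sup>2 - 2 * \<rho> * t))"
  define \<nu> where "\<nu> = complex_of_real \<mu> - lam - 1 / 2"
  define m where "m = complex_of_real (1 / 2 - \<mu>)"
  define lhs where "lhs = (\<lambda>t::real. complex_of_real ((1 - t\<^sup>2) powr (1 / 4 - \<mu> / 2)) *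
                  legendre_P \<nu> m (complex_of_real (R t + \<rho>)) *
                  ferrers_P \<nu> m (R t - \<rho>))"
  define trm where "trm = (\<lambda>n::nat. pochhammer lam n * pochhammer (2 * complex_of_real \<mu> - lam) n /
                  (pochhammer (2 * complex_of_real \<mu>) n *
                   complex_of_real (Gamma (\<mu> + 1 / 2 + real n))) *
                  complex_of_real (\<rho> powr (\<mu> - 1 / 2 + real n)) *
                  gegenbauer n (complex_of_real \<mu>) (complex_of_real x))"
  define g b where "g = complex_of_real (\<mu> + 1 / 2)" and "b = 2 * complex_of_real \<mu> - lam"
  define F where "F = eval_fps (gauss_fps lam b g)"
  define G where "G = (\<lambda>t. F (complex_of_real ((1 - R t - \<rho>) / 2)) * F (complex_of_real ((1 - R t + \<rho>) / 2)))"
  define \<Gamma> where "\<Gamma> = Gamma (\<mu> + 1 / 2)"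
  have \<Gamma>: "\<Gamma> > 0" using assms by (simp add: \<Gamma>_def Gamma_real_pos)
  have g: "g \<notin> \<int>\<^sub>\<le>\<^sub>0"
  proof
    assume "g \<in> \<int>\<^sub>\<le>\<^sub>0"
    then have "Re g \<le> 0" by (auto simp: nonpos_Ints_def)
    with assms(1) show False by (simp add: g_def)
  qed
  have ab: "lam + b = 2 * g - 1" by (simp add: b_def g_def)
  have R: "(R t)\<^sup>2 = 1 + \<rho>\<^sup>2 - 2 * \<rho> * t" "1 - \<rho> \<le> R t" "R t \<le> 1 + \<rho>" if "\<bar>t\<bar> \<le> 1" for t
    using generating_function_bounds[OF assms(3,4) that] by (simp_all add: R_def)
  have u1: "norm (complex_of_real ((1 - R t - \<rho>) / 2)) < 1"
    and v1: "norm (complex_of_real ((1 - R t + \<rho>) / 2)) < 1" if "\<bar>t\<bar> \<le> 1" for t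
    using R(2,3)[OF that] assms(3,4) unfolding norm_of_real by (auto simp: abs_less_iff)

  \<comment> \<open>the terms of the series are those of the generating function, up to the constant P\<close>
  define P where "P = complex_of_real (\<rho> powr (\<mu> - 1 / 2) / \<Gamma>)"
  define s where "s = complex_of_real ((1 - x) / 2)"
  define c where "c = (\<lambda>n. \<Sum>k\<le>n. appell_coeff lam b g k (n - k) * (- s) ^ k * (1 - s) ^ (n - k))"
  have trm: "trm n = P * (c n * complex_of_real \<rho> ^ n)" for n
  proof -
    have "\<mu> + 1 / 2 \<notin> \<int>\<^sub>\<le>\<^sub>0" using assms by (auto simp: nonpos_Ints_def)
    then have "Gamma (\<mu> + 1 / 2 + real n) = \<Gamma> * pochhammer (\<mu> + 1 / 2) n"
      using \<Gamma> by (simp add: pochhammer_Gamma \<Gamma>_def)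
    then have Gam: "complex_of_real (Gamma (\<mu> + 1 / 2 + real n)) = complex_of_real \<Gamma> * pochhammer g n"
      by (simp only: of_real_mult g_def pochhammer_of_real)
    have rho: "complex_of_real (\<rho> powr (\<mu> - 1 / 2 + real n))
        = complex_of_real (\<rho> powr (\<mu> - 1 / 2)) * complex_of_real \<rho> ^ n"
      using assms by (simp add: powr_add powr_realpow)
    have mu_g: "complex_of_real \<mu> + 1 / 2 = g" by (simp add: g_def)
    have geg: "gegenbauer n (complex_of_real \<mu>) (complex_of_real x)
        = pochhammer (2 * complex_of_real \<mu>) n * pochhammer g n *
          (\<Sum>k\<le>n. jacobi_weight g k (n - k) * (- s) ^ k * (1 - s) ^ (n - k))"
      using gegenbauer_expansion[of "complex_of_real \<mu>" n "complex_of_real x", unfolded mu_g, OF g]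
      by (simp add: s_def)
    have c: "c n = pochhammer lam n * pochhammer b n *
          (\<Sum>k\<le>n. jacobi_weight g k (n - k) * (- s) ^ k * (1 - s) ^ (n - k))"
      unfolding c_def sum_distrib_left
      by (intro sum.cong refl) (simp add: appell_coeff_eq_jacobi_weight)
    have nz: "pochhammer (2 * complex_of_real \<mu>) n \<noteq> 0"
    proof (rule pochhammer_nonzero)
      show "2 * complex_of_real \<mu> \<notin> \<int>\<^sub>\<le>\<^sub>0"
      proof
        assume "2 * complex_of_real \<mu> \<in> \<int>\<^sub>\<le>\<^sub>0"
        then obtain k :: int where k: "k \<le> 0" "2 * complex_of_real \<mu> = of_int k"
          by (auto simp: nonpos_Ints_def)
        from arg_cong[OF k(2), of Re] have "2 * \<mu> = of_int k" by simp
        moreover have "k \<le> - 1 \<or> k = 0" using k(1) by linarith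
        \<comment> \<open>\<open>2 * \<mu> > - 1\<close> and \<open>\<mu> \<noteq> 0\<close> leave no nonpositive integer\<close>
        ultimately show False using assms(1,2) by auto
      qed
    qed
    have nz2: "pochhammer g n \<noteq> 0" by (rule pochhammer_nonzero[OF g])
    show ?thesis
    proof -
      have "A * B / (M * (\<Gamma>' * q)) * (h * e) * (M * q * S) = h / \<Gamma>' * (A * B * S * e)"
        if "M \<noteq> 0" "q \<noteq> 0" for A B M \<Gamma>' q h e S :: complex
        using that by simp
      from this[OF nz nz2] show ?thesis
        unfolding trm_def Gam rho geg c P_def b_def[symmetric] of_real_divide .
    qed
  qed
  have sums: "(\<lambda>n. c n * complex_of_real \<rho> ^ n) sums G x"
  proof -
    have "csqrt (1 + (complex_of_real \<rho>)\<^sup>2 - 2 * complex_of_real \<rho> * complex_of_real x) = complex_of_real (R x)"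
    proof -
      have "0 \<le> 1 + \<rho>\<^sup>2 - 2 * \<rho> * x" using R(1)[of x, symmetric] assms by simp
      then have "csqrt (complex_of_real (1 + \<rho>\<^sup>2 - 2 * \<rho> * x)) = complex_of_real (R x)"
        unfolding R_def by (rule of_real_sqrt[symmetric])
      then show ?thesis by simp
    qed
    moreover have "norm (complex_of_real \<rho>) < 1" "\<bar>x\<bar> \<le> 1" using assms by auto
    ultimately show ?thesis
      using brafman_ultraspherical(3)[OF g ab, of x "complex_of_real \<rho>"]
      by (simp add: c_def G_def F_def s_def)
  qed
  have trm_sums: "trm sums (P * G x)"
    using sums_mult[OF sums, of P] by (simp only: trm[symmetric])

  define K where "K = complex_of_real (2 powr (1 / 2 - \<mu>) / \<Gamma>)"
  have lhs: "lhs t = K * (P * G t)" if t: "\<bar>t\<bar> < 1" for t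
  proof -
    define z y where "z = R t + \<rho>" and "y = R t - \<rho>"
    have t': "\<bar>t\<bar> \<le> 1" using t by simp
    have "1 < z" "- 1 < y" "y < 1"
      using generating_function_bounds(4,5)[OF assms(3,4) t' t] assms(3,4)
      unfolding z_def y_def R_def by linarith+
    have par: "1 - m = g" "g - - \<nu> = b" "g - (\<nu> + 1) = lam" "b - (\<nu> + 1) = complex_of_real (\<mu> - 1 / 2)"
      by (simp_all add: m_def g_def \<nu>_def b_def)
    have G_\<Gamma>: "Gamma g = complex_of_real \<Gamma>"
      unfolding g_def \<Gamma>_def by (rule Gamma_complex_of_real)
    have leg: "legendre_P \<nu> m (complex_of_real z)
        = complex_of_real (((z\<^sup>2 - 1) / 4) powr (\<mu> / 2 - 1 / 4) / \<Gamma>) * F (complex_of_real ((1 - R t - \<rho>) / 2))"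
    proof -
      have arg: "(1 - complex_of_real z) / 2 = complex_of_real ((1 - R t - \<rho>) / 2)"
        by (simp add: z_def)
      have "hyp2F1 (- \<nu>) (\<nu> + 1) g ((1 - complex_of_real z) / 2) =
          (1 - (1 - complex_of_real z) / 2) powr complex_of_real (\<mu> - 1 / 2) * F ((1 - complex_of_real z) / 2)"
        using hyp2F1_euler[OF g u1[OF t'], of "- \<nu>" "\<nu> + 1"]
        unfolding par arg[symmetric] F_def gauss_fps_commute[of b lam] .
      then have leg: "legendre_P \<nu> m (complex_of_real z) = 1 / complex_of_real \<Gamma> *
         (((complex_of_real z + 1) / (complex_of_real z - 1)) powr (m / 2)
           * (1 - (1 - complex_of_real z) / 2) powr complex_of_real (\<mu> - 1 / 2)) * F ((1 - complex_of_real z) / 2)"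
        unfolding legendre_P_def par G_\<Gamma> by (simp only: mult_ac)
      have base: "(complex_of_real z + 1) / (complex_of_real z - 1) = complex_of_real ((z + 1) / (z - 1))"
        by simp
      have half: "1 - (1 - complex_of_real z) / 2 = complex_of_real ((z + 1) / 2)"
        by (simp add: field_simps)
      have prod: "(z - 1) * (z + 1) = z\<^sup>2 - 1"
        by (simp add: power2_eq_square algebra_simps)
      have "z + 1 > 0" "z - 1 > 0" using \<open>1 < z\<close> by simp_all
      note pre = legendre_prefactor[OF this, of \<mu>, unfolded prod]
      show ?thesis
        unfolding leg base half unfolding m_def pre arg by simp
    qed
    have fer: "ferrers_P \<nu> m y
        = complex_of_real (((1 - y\<^sup>2) / 4) powr (\<mu> / 2 - 1 / 4) / \<Gamma>) * F (complex_of_real ((1 - R t + \<rho>) / 2))"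
    proof -
      have arg: "(1 - y) / 2 = (1 - R t + \<rho>) / 2"
        by (simp add: y_def)
      have "hyp2F1 (- \<nu>) (\<nu> + 1) g (complex_of_real ((1 - y) / 2)) =
          (1 - complex_of_real ((1 - y) / 2)) powr complex_of_real (\<mu> - 1 / 2) * F (complex_of_real ((1 - y) / 2))"
        using hyp2F1_euler[OF g v1[OF t'], of "- \<nu>" "\<nu> + 1"]
        unfolding par arg[symmetric] F_def gauss_fps_commute[of b lam] .
      then have fer: "ferrers_P \<nu> m y = 1 / complex_of_real \<Gamma> *
         (complex_of_real ((1 + y) / (1 - y)) powr (m / 2)
           * (1 - complex_of_real ((1 - y) / 2)) powr complex_of_real (\<mu> - 1 / 2)) * F (complex_of_real ((1 - y) / 2))"
        unfolding ferrers_P_def par G_\<Gamma> by (simp only: mult_ac)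
      have half: "1 - complex_of_real ((1 - y) / 2) = complex_of_real ((1 + y) / 2)"
        by (simp add: field_simps)
      have prod: "(1 - y) * (1 + y) = 1 - y\<^sup>2"
        by (simp add: power2_eq_square algebra_simps)
      have "1 + y > 0" "1 - y > 0" using \<open>- 1 < y\<close> \<open>y < 1\<close> by simp_all
      note pre = legendre_prefactor[OF this, of \<mu>, unfolded prod]
      show ?thesis
        unfolding fer half unfolding m_def pre arg by simp
    qed
    have t2: "1 - t\<^sup>2 > 0" using t by (simp add: abs_square_less_1)
    have zy: "(z\<^sup>2 - 1) / 4 * ((1 - y\<^sup>2) / 4) = (\<rho> / 2)\<^sup>2 * (1 - t\<^sup>2)"
    proof -
      define q where "q = R t"
      have q: "q * q = 1 + \<rho> * \<rho> - 2 * \<rho> * t"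
        using R(1)[OF t'] by (simp add: q_def power2_eq_square)
      have zq: "z\<^sup>2 - 1 = 2 * \<rho> * (\<rho> - t + q)"
        using q unfolding z_def q_def[symmetric] power2_eq_square by (simp add: algebra_simps)
      have yq: "1 - y\<^sup>2 = 2 * \<rho> * (t - \<rho> + q)"
        using q unfolding y_def q_def[symmetric] power2_eq_square by (simp add: algebra_simps)
      have "(\<rho> - t + q) * (t - \<rho> + q) = q * q - (t - \<rho>) * (t - \<rho>)"
        by (simp add: algebra_simps)
      also have "\<dots> = 1 - t\<^sup>2" unfolding q by (simp add: algebra_simps power2_eq_square)
      finally have conj: "(\<rho> - t + q) * (t - \<rho> + q) = 1 - t\<^sup>2" .
      have "(2 * \<rho> * A) / 4 * ((2 * \<rho> * B) / 4) = (\<rho> / 2)\<^sup>2 * (A * B)" for A B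
        by (simp add: power2_eq_square)
      then show ?thesis unfolding zq yq conj[symmetric] .
    qed
    have pos: "(z\<^sup>2 - 1) / 4 > 0" "(1 - y\<^sup>2) / 4 > 0"
      using \<open>1 < z\<close> \<open>- 1 < y\<close> \<open>y < 1\<close> by (auto simp: abs_square_less_1 intro!: one_less_power)
    note key = legendre_product_prefactor[OF pos t2 assms(3) zy, of \<mu>]
    have "lhs t = complex_of_real ((1 - t\<^sup>2) powr (1 / 4 - \<mu> / 2) * (((z\<^sup>2 - 1) / 4) powr (\<mu> / 2 - 1 / 4) * ((1 - y\<^sup>2) / 4) powr (\<mu> / 2 - 1 / 4)) / (\<Gamma> * \<Gamma>)) * G t"
      unfolding lhs_def z_def[symmetric] y_def[symmetric] leg fer G_def by simp
    also have "\<dots> = K * (P * G t)"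
      unfolding key K_def P_def by simp
    finally show ?thesis .
  qed

  have main: "if \<bar>x\<bar> < 1 then lhs x = K * (P * G x)
         else (lhs \<longlongrightarrow> K * (P * G x)) (at x within {-1<..<1})"
  proof (cases "\<bar>x\<bar> < 1")
    case False
    have contF: "continuous_on {-1..1} (\<lambda>t. F (complex_of_real (h t)))"
      if "continuous_on {-1..1} h" "\<And>t. \<bar>t\<bar> \<le> 1 \<Longrightarrow> norm (complex_of_real (h t)) < 1" for h :: "real \<Rightarrow> real"
      unfolding F_def
    proof (intro continuous_on_eval_fps' continuous_on_of_real that(1) image_subsetI)
      fix t :: real assume "t \<in> {-1..1}"
      then have "\<bar>t\<bar> \<le> 1" by auto
      from less_fps_conv_radius_gauss[OF g that(2)[OF this]]
      show "complex_of_real (h t) \<in> eball 0 (fps_conv_radius (gauss_fps lam b g))"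
        by simp
    qed
    have "continuous_on {-1..1} R" unfolding R_def by (intro continuous_intros)
    then have "continuous_on {-1..1} (\<lambda>t. K * (P * G t))"
      unfolding G_def using u1 v1 by (intro continuous_intros contF) auto
    then have "((\<lambda>t. K * (P * G t)) \<longlongrightarrow> K * (P * G x)) (at x within {-1..1})"
      using assms(5,6) by (simp add: continuous_on_def)
    then have "((\<lambda>t. K * (P * G t)) \<longlongrightarrow> K * (P * G x)) (at x within {-1<..<1})"
      by (rule tendsto_within_subset) auto
    moreover have "eventually (\<lambda>t. K * (P * G t) = lhs t) (at x within {-1<..<1})"
      unfolding eventually_at_filter by (intro always_eventually) (auto simp: lhs)
    ultimately have "(lhs \<longlongrightarrow> K * (P * G x)) (at x within {-1<..<1})"
      by (rule Lim_transform_eventually)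
    with False show ?thesis by simp
  qed (simp add: lhs)
  have "summable trm \<and>
        (if \<bar>x\<bar> < 1 then lhs x = K * (\<Sum>n. trm n)
         else (lhs \<longlongrightarrow> K * (\<Sum>n. trm n)) (at x within {-1<..<1}))"
    using main trm_sums by (simp only: sums_iff)
  then show ?thesis
    unfolding Let_def K_def \<Gamma>_def trm_def lhs_def R_def \<nu>_def m_def .
qed

end
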